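(* Let $c>0$ and $(\gamma_1,\gamma_2)\in\mathbb{R}\times\mathbb{R}^*$. The metrics $\{d\sigma_{m,\ell}^2\}$, with $(m,\ell)\in\Lambda_c$, form a two-parameter family of rotationally invariant $c$-spherical Ricci metrics on the torus $\mathbb{R}^2/\Gamma_{\frac{\pi}{\sqrt c}}(\gamma_1,\gamma_2)$ (that is, each $d\sigma^2_{m,\ell}$ on $\mathbb{R}^2$ descends to a $c$-spherical Ricci metric on this quotient torus). Furthermore, there exist infinitely many metrics in this family, on this torus, that are not isometric to one another.
   Context: $\mathbb{R}^*=\mathbb{R}\setminus\{0\}$. For $c>0$, a Riemannian metric on a smooth connected surface is called a $c$-spherical Ricci metric if its Gaussian curvature $K$ satisfies $(K-c)\Delta K-|\nabla K|^2-4K(K-c)^2=0$, where $\nabla$ and $\Delta$ are the gradient and Laplace–Beltrami operator of the metric. For $c>0$ set $\Lambda_c=\{(m,\ell)\in\mathbb{R}^2 : m>0 \text{ and } \ell>\sqrt{c\,m}\}$. For $(m,\ell)\in\Lambda_c$ let $$f_{m,\ell}(s)=\sqrt{\frac{\ell+\sqrt{\ell^2-c\,m}\,\sin(2\sqrt c\,s)}{c}},\qquad s\in\mathbb{R},$$ and let $d\sigma_{m,\ell}^2=ds^2+f_{m,\ell}(s)^2\,dt^2$ be the corresponding metric on $\mathbb{R}^2$ with coordinates $(s,t)$. A metric of the warped form $ds^2+f(s)^2dt^2$ is called rotationally symmetric (rotationally invariant): translations in $t$ act by isometries. The lattice is $\Gamma_{\frac{\pi}{\sqrt c}}(\gamma_1,\gamma_2)=\left(\frac{\pi}{\sqrt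 c},\gamma_1\right)\mathbb{Z}\oplus(0,\gamma_2)\mathbb{Z}\subset\mathbb{R}^2$, acting on $\mathbb{R}^2$ by translations. *)

theory Defs
  imports "HOL-Analysis.Analysis"
begin

definition partial :: "2 \<Rightarrow> (real^2 \<Rightarrow> 'b::real_normed_vector) \<Rightarrow> real^2 \<Rightarrow> 'b" where
  "partial i f p = frechet_derivative f (at p) (axis i 1)"

primrec Ck_on :: "nat \<Rightarrow> (real^2) set \<Rightarrow> (real^2 \<Rightarrow> 'b::real_normed_vector) \<Rightarrow> bool" where
  "Ck_on 0 U f \<longleftrightarrow> continuous_on U f"
| "Ck_on (Suc n) U f \<longleftrightarrow> f differentiable_on U \<and> (\<forall>i. Ck_on n U (partial i f))"

text \<open>Only used on open sets, so that the Frechet derivatives at points of the set are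
  determined by the values on the set.\<close>

definition smooth_on :: "(real^2) set \<Rightarrow> (real^2 \<Rightarrow> 'b::real_normed_vector) \<Rightarrow> bool" where
  "smooth_on U f \<longleftrightarrow> (\<forall>n. Ck_on n U f)"

text \<open>A surface is a set of points with a family of local parametrizations \<open>(V, x)\<close>, where
  \<open>V\<close> is an open set of the plane and \<open>x\<close> maps \<open>V\<close> injectively onto a subset of the surface.
  Values of \<open>x\<close> outside \<open>V\<close> are irrelevant.\<close>

type_synonym 'a param = "(real^2) set \<times> (real^2 \<Rightarrow> 'a)"

record 'a surface =
  points :: "'a set"
  params :: "'a param set"

definition open_in_surface :: "'a surface \<Rightarrow> 'a set \<Rightarrow> bool" where
  "open_in_surface S A \<longleftrightarrow>
     A \<subseteq> points S \<and> (\<forall>(V, x) \<in> params S. open {p \<in> V. x p \<in> A})"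

definition surface_topology :: "'a surface \<Rightarrow> 'a topology" where
  "surface_topology S = topology (open_in_surface S)"

lemma istopology_open_in_surface: "istopology (open_in_surface S)"
  unfolding istopology_def
proof (intro conjI allI impI)
  fix A B assume A: "open_in_surface S A" and B: "open_in_surface S B"
  have "open {p \<in> V. x p \<in> A \<inter> B}" if "(V, x) \<in> params S" for V x
  proof -
    have "{p \<in> V. x p \<in> A \<inter> B} = {p \<in> V. x p \<in> A} \<inter> {p \<in> V. x p \<in> B}" by auto
    then show ?thesis using A B that by (auto simp: open_in_surface_def)
  qed
  then show "open_in_surface S (A \<inter> B)"
    using A by (auto simp: open_in_surface_def)
next
  fix \<K> assume K: "\<forall>A\<in>\<K>. open_in_surface S A"
  have "open {p \<in> V. x p \<in> \<Union>\<K>}" if "(V, x) \<in> params S" for V x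
  proof -
    have "{p \<in> V. x p \<in> \<Union>\<K>} = (\<Union>A\<in>\<K>. {p \<in> V. x p \<in> A})" by auto
    moreover have "open {p \<in> V. x p \<in> A}" if "A \<in> \<K>" for A
      using K that \<open>(V, x) \<in> params S\<close> by (force simp: open_in_surface_def)
    ultimately show ?thesis by (metis (mono_tags, lifting) open_UN)
  qed
  then show "open_in_surface S (\<Union>\<K>)"
    using K by (auto simp: open_in_surface_def)
qed

lemma openin_surface_topology: "openin (surface_topology S) A \<longleftrightarrow> open_in_surface S A"
  by (simp add: surface_topology_def topology_inverse' istopology_open_in_surface)

text \<open>The openness of the domain of each coordinate expression of \<open>\<phi>\<close> expresses that \<open>\<phi>\<close> is
  continuous.\<close>

definition smooth_map :: "'a surface \<Rightarrow> 'b surface \<Rightarrow> ('a \<Rightarrow> 'b) \<Rightarrow> bool" where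
  "smooth_map S S' \<phi> \<longleftrightarrow>
     \<phi> ` points S \<subseteq> points S' \<and>
     (\<forall>(V, x) \<in> params S. \<forall>(W, y) \<in> params S'.
        open {p \<in> V. \<phi> (x p) \<in> y ` W} \<and>
        smooth_on {p \<in> V. \<phi> (x p) \<in> y ` W} (inv_into W y \<circ> \<phi> \<circ> x))"

text \<open>The condition \<open>smooth_map S S id\<close> is the smooth compatibility of the parametrizations:
  the coordinate expressions of the identity are the transition maps.\<close>

definition smooth_surface :: "'a surface \<Rightarrow> bool" where
  "smooth_surface S \<longleftrightarrow>
     (\<forall>(V, x) \<in> params S. open V \<and> inj_on x V \<and> x ` V \<subseteq> points S) \<and>
     points S = (\<Union>(V, x) \<in> params S. x ` V) \<and>
     smooth_map S S id \<and>
     Hausdorff_space (surface_topology S) \<and>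
     second_countable (surface_topology S)"

text \<open>A metric is given by its matrix of coefficients in each parametrization.\<close>

type_synonym 'a metric = "'a param \<Rightarrow> real^2 \<Rightarrow> real^2^2"

text \<open>\<open>g = \<phi>\<^sup>* g'\<close>, written in coordinates.\<close>

definition is_pullback ::
    "'a surface \<Rightarrow> 'a metric \<Rightarrow> 'b surface \<Rightarrow> 'b metric \<Rightarrow> ('a \<Rightarrow> 'b) \<Rightarrow> bool" where
  "is_pullback S g S' g' \<phi> \<longleftrightarrow>
     (\<forall>(V, x) \<in> params S. \<forall>(W, y) \<in> params S'. \<forall>p \<in> V. \<forall>q \<in> W. \<phi> (x p) = y q \<longrightarrow>
        (let J = jacobian (inv_into W y \<circ> \<phi> \<circ> x) (at p)
         in g (V, x) p = transpose J ** g' (W, y) q ** J))"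

text \<open>\<open>is_pullback S g S g id\<close> is the transformation rule of a covariant tensor under
  changes of parametrization.\<close>

definition riemannian_metric :: "'a surface \<Rightarrow> 'a metric \<Rightarrow> bool" where
  "riemannian_metric S g \<longleftrightarrow>
     (\<forall>(V, x) \<in> params S.
        (\<forall>i j. smooth_on V (\<lambda>p. g (V, x) p $ i $ j)) \<and>
        (\<forall>p \<in> V. transpose (g (V, x) p) = g (V, x) p \<and>
                 (\<forall>v. v \<noteq> 0 \<longrightarrow> v \<bullet> (g (V, x) p *v v) > 0))) \<and>
     is_pullback S g S g id"

definition isometry ::
    "'a surface \<Rightarrow> 'a metric \<Rightarrow> 'b surface \<Rightarrow> 'b metric \<Rightarrow> ('a \<Rightarrow> 'b) \<Rightarrow> bool" where
  "isometry S g S' g' \<phi> \<longleftrightarrow>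
     bij_betw \<phi> (points S) (points S') \<and>
     smooth_map S S' \<phi> \<and> smooth_map S' S (inv_into (points S) \<phi>) \<and>
     is_pullback S g S' g' \<phi>"

definition isometric ::
    "'a surface \<Rightarrow> 'a metric \<Rightarrow> 'b surface \<Rightarrow> 'b metric \<Rightarrow> bool" where
  "isometric S g S' g' \<longleftrightarrow> (\<exists>\<phi>. isometry S g S' g' \<phi>)"

text \<open>For \<open>\<pi>\<close> a surjective local diffeomorphism, \<open>g\<close> descends to \<open>g'\<close>; then \<open>g'\<close> is uniquely
  determined by \<open>g\<close> (on the domains of the parametrizations).\<close>

definition descends_to ::
    "'a surface \<Rightarrow> 'a metric \<Rightarrow> 'b surface \<Rightarrow> 'b metric \<Rightarrow> ('a \<Rightarrow> 'b) \<Rightarrow> bool" where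
  "descends_to S g S' g' \<pi> \<longleftrightarrow>
     smooth_map S S' \<pi> \<and> \<pi> ` points S = points S' \<and> is_pullback S g S' g' \<pi>"

definition christoffel :: "(real^2 \<Rightarrow> real^2^2) \<Rightarrow> 2 \<Rightarrow> 2 \<Rightarrow> 2 \<Rightarrow> real^2 \<Rightarrow> real" where
  "christoffel g k i j p =
     (\<Sum>l\<in>UNIV. matrix_inv (g p) $ k $ l *
        (partial i (\<lambda>q. g q $ j $ l) p + partial j (\<lambda>q. g q $ i $ l) p
          - partial l (\<lambda>q. g q $ i $ j) p)) / 2"

text \<open>The \<open>k\<close>-th component of \<open>R(\<partial>\<^sub>1, \<partial>\<^sub>2) \<partial>\<^sub>2\<close>, with
  \<open>R(X, Y) Z = \<nabla>\<^sub>X \<nabla>\<^sub>Y Z - \<nabla>\<^sub>Y \<nabla>\<^sub>X Z - \<nabla>\<^bsub>[X, Y]\<^esub> Z\<close>.\<close>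

definition riemann_122 :: "(real^2 \<Rightarrow> real^2^2) \<Rightarrow> 2 \<Rightarrow> real^2 \<Rightarrow> real" where
  "riemann_122 g k p =
     partial 1 (christoffel g k 2 2) p - partial 2 (christoffel g k 1 2) p
     + (\<Sum>m\<in>UNIV. christoffel g m 2 2 p * christoffel g k 1 m p
                  - christoffel g m 1 2 p * christoffel g k 2 m p)"

definition gauss_curvature :: "(real^2 \<Rightarrow> real^2^2) \<Rightarrow> real^2 \<Rightarrow> real" where
  "gauss_curvature g p = (\<Sum>k\<in>UNIV. g p $ k $ 1 * riemann_122 g k p) / det (g p)"

definition gradient :: "(real^2 \<Rightarrow> real^2^2) \<Rightarrow> (real^2 \<Rightarrow> real) \<Rightarrow> real^2 \<Rightarrow> real^2" where
  "gradient g u p = matrix_inv (g p) *v (\<chi> j. partial j u p)"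

definition norm_sq :: "(real^2 \<Rightarrow> real^2^2) \<Rightarrow> (real^2 \<Rightarrow> real^2) \<Rightarrow> real^2 \<Rightarrow> real" where
  "norm_sq g X p = X p \<bullet> (g p *v X p)"

definition laplace_beltrami ::
    "(real^2 \<Rightarrow> real^2^2) \<Rightarrow> (real^2 \<Rightarrow> real) \<Rightarrow> real^2 \<Rightarrow> real" where
  "laplace_beltrami g u p =
     (\<Sum>i\<in>UNIV. partial i (\<lambda>q. sqrt (det (g q)) * gradient g u q $ i) p) / sqrt (det (g p))"

definition spherical_ricci_metric :: "real \<Rightarrow> 'a surface \<Rightarrow> 'a metric \<Rightarrow> bool" where
  "spherical_ricci_metric c S g \<longleftrightarrow>
     c > 0 \<and> smooth_surface S \<and> connected_space (surface_topology S) \<and>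
     riemannian_metric S g \<and>
     (\<forall>(V, x) \<in> params S. \<forall>p \<in> V.
        let G = g (V, x); K = gauss_curvature G in
          (K p - c) * laplace_beltrami G K p - norm_sq G (gradient G K) p
            - 4 * K p * (K p - c)^2 = 0)"

definition lattice :: "real \<Rightarrow> real \<Rightarrow> real \<Rightarrow> (real^2) set" where
  "lattice \<tau> \<gamma>1 \<gamma>2 =
     {of_int a *\<^sub>R vector [\<tau>, \<gamma>1] + of_int b *\<^sub>R vector [0, \<gamma>2] | a b :: int. True}"

definition plane :: "(real^2) surface" where
  "plane = \<lparr>points = UNIV, params = {(UNIV, id)}\<rparr>"

definition torus_proj :: "(real^2) set \<Rightarrow> real^2 \<Rightarrow> (real^2) set" where
  "torus_proj \<Gamma> p = {(a, b). b - a \<in> \<Gamma>} `` {p}"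

text \<open>The quotient smooth structure: the parametrizations are the restrictions of the projection
  to the open sets on which it is injective.\<close>

definition torus :: "(real^2) set \<Rightarrow> (real^2) set surface" where
  "torus \<Gamma> = \<lparr>points = UNIV // {(a, b). b - a \<in> \<Gamma>},
              params = {(V, torus_proj \<Gamma>) | V. open V \<and> inj_on (torus_proj \<Gamma>) V}\<rparr>"

definition Lam :: "real \<Rightarrow> (real \<times> real) set" where
  "Lam c = {(m, l). m > 0 \<and> l > sqrt (c * m)}"

definition warp :: "real \<Rightarrow> real \<Rightarrow> real \<Rightarrow> real \<Rightarrow> real" where
  "warp c m l s = sqrt ((l + sqrt (l^2 - c * m) * sin (2 * sqrt c * s)) / c)"

text \<open>The metric \<open>ds\<^sup>2 + f(s)\<^sup>2 dt\<^sup>2\<close> on the plane with coordinates \<open>s = p $ 1\<close>, \<open>t = p $ 2\<close>.\<close>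

definition warped_metric :: "(real \<Rightarrow> real) \<Rightarrow> (real^2) metric" where
  "warped_metric f = (\<lambda>_ p. vector [vector [1, 0], vector [0, (f (p $ 1))^2]])"

definition dsigma :: "real \<Rightarrow> real \<Rightarrow> real \<Rightarrow> (real^2) metric" where
  "dsigma c m l = warped_metric (warp c m l)"

text \<open>A translation of the plane maps cosets of \<open>\<Gamma>\<close> to cosets of \<open>\<Gamma>\<close>; the image map is the
  induced map of the quotient.\<close>

definition rotationally_invariant :: "(real^2) set \<Rightarrow> (real^2) set metric \<Rightarrow> bool" where
  "rotationally_invariant \<Gamma> h \<longleftrightarrow>
     (\<forall>r. isometry (torus \<Gamma>) h (torus \<Gamma>) h (image (\<lambda>p. p + vector [0, r])))"

end

theory Submission
  imports Defs
begin

text \<open>A warped metric \<open>ds\<^sup>2 + f(s)\<^sup>2 dt\<^sup>2\<close> has curvature \<open>K = - f'' / f\<close>. For the warping functions of the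
family, \<open>f'' / f = - c + m / f\<^sup>4\<close>, so that \<open>c - K = m / f\<^sup>4\<close> and \<open>log (c - K) = log m - 4 log f\<close>. Because
\<open>\<Delta> log f = f'' / f = - K\<close>, this gives \<open>\<Delta> log (c - K) = 4 K\<close>, which is the spherical Ricci equation divided
by \<open>(K - c)\<^sup>2\<close> (\<open>spherical_ricci_warped\<close>, \<open>curvature_ode\<close>).

The metric has period \<open>\<pi> / \<surd>c\<close> in \<open>s\<close> and does not depend on \<open>t\<close>, hence is invariant under the lattice and
under all translations in \<open>t\<close>. The parametrizations of the torus are restrictions of the projection, so every
coordinate expression of the projection, of a transition map or of a translation of the torus is
locally a translation of the plane (\<open>chart_translation\<close>). This gives the smooth structure on the torus,
the descended metric and its rotational invariance.

To distinguish metrics of the family, the maximum of the curvature serves as an invariant. That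
isometries preserve curvature is proved for warped metrics only (\<open>local_isometry_curvature\<close>): if
\<open>\<psi> = (u, v)\<close> is a local isometry, then \<open>|\<nabla>u| = 1\<close> and \<open>\<Delta>u\<close> is the known function \<open>(f\<^sub>2' / f\<^sub>2)(u)\<close>, and
Bochner's formula for \<open>u\<close> expresses the curvature of the source through that of the target. The
maximal curvature of the metric with parameters \<open>(m, l)\<close> is \<open>c - m c\<^sup>2 / (l + r)\<^sup>2\<close> with
\<open>r = sqrt (l\<^sup>2 - c m)\<close>, and on the curve \<open>l = 1\<close> it takes a different value for each \<open>r\<close> between \<open>0\<close> and \<open>1\<close>
(\<open>isometric_max_curvature\<close>).\<close>

section \<open>Partial derivatives of smooth functions on the plane\<close>

lemma partial_eqI:
  "(f has_derivative f') (at p) \<Longrightarrow> partial i f p = f' (axis i 1)"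
  unfolding partial_def using frechet_derivative_at by metis

lemma DERIV_partial:
  fixes f :: "real^2 \<Rightarrow> real"
  assumes "f differentiable (at (p + t *\<^sub>R axis i 1))"
  shows "((\<lambda>t. f (p + t *\<^sub>R axis i 1)) has_real_derivative partial i f (p + t *\<^sub>R axis i 1)) (at t)"
proof -
  have "((\<lambda>t. p + t *\<^sub>R axis i 1) has_derivative (\<lambda>h. h *\<^sub>R axis i 1)) (at t)"
    by (auto intro!: derivative_eq_intros)
  moreover have f: "(f has_derivative frechet_derivative f (at (p + t *\<^sub>R axis i 1))) (at (p + t *\<^sub>R axis i 1))"
    using assms frechet_derivative_works by blast
  ultimately have "((\<lambda>t. f (p + t *\<^sub>R axis i 1)) has_derivative
      (\<lambda>h. frechet_derivative f (at (p + t *\<^sub>R axis i 1)) (h *\<^sub>R axis i 1))) (at t)"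
    by (rule has_derivative_compose)
  moreover have "frechet_derivative f (at (p + t *\<^sub>R axis i 1)) (h *\<^sub>R axis i 1) =
      partial i f (p + t *\<^sub>R axis i 1) * h" for h
    using linear_scale[OF has_derivative_linear[OF f]] by (simp add: partial_def)
  ultimately show ?thesis
    by (simp add: has_field_derivative_def)
qed

lemma has_derivative_cong_open:
  assumes "open U" "p \<in> U" "\<And>q. q \<in> U \<Longrightarrow> f q = g q"
  shows "(f has_derivative D) (at p) \<longleftrightarrow> (g has_derivative D) (at p)"
  using assms has_derivative_transform_within_open[of _ D p UNIV U] by metis

lemma partial_cong_open:
  assumes "open U" "p \<in> U" "\<And>q. q \<in> U \<Longrightarrow> f q = g q"
  shows "partial i f p = partial i g p"
  using has_derivative_cong_open[OF assms] by (simp add: partial_def frechet_derivative_def)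

lemma Ck_on_cong:
  assumes "open U" "\<And>q. q \<in> U \<Longrightarrow> f q = g q"
  shows "Ck_on n U f \<longleftrightarrow> Ck_on n U g"
  using assms(2)
proof (induction n arbitrary: f g)
  case 0
  then show ?case by (auto cong: continuous_on_cong)
next
  case (Suc n)
  have "f differentiable_on U \<longleftrightarrow> g differentiable_on U"
    using has_derivative_cong_open[OF assms(1) _ Suc.prems]
    by (auto simp: differentiable_on_eq_differentiable_at[OF assms(1)] differentiable_def)
  moreover have "Ck_on n U (partial i f) \<longleftrightarrow> Ck_on n U (partial i g)" for i
    by (intro Suc.IH partial_cong_open[OF assms(1), of _ f g] Suc.prems)
  ultimately show ?case by simp
qed

lemma smooth_on_subset:
  assumes "smooth_on U f" "V \<subseteq> U"
  shows "smooth_on V f"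
proof -
  have "Ck_on n U f \<Longrightarrow> Ck_on n V f" for n
    using assms(2) by (induction n arbitrary: f)
      (auto intro: continuous_on_subset differentiable_on_subset)
  then show ?thesis using assms(1) by (simp add: smooth_on_def)
qed

lemma smooth_on_partial: "smooth_on U f \<Longrightarrow> smooth_on U (partial i f)"
  unfolding smooth_on_def using Ck_on.simps(2) by blast

lemma smooth_on_differentiable:
  assumes "smooth_on U f" "open U" "p \<in> U"
  shows "f differentiable (at p)"
  using assms Ck_on.simps(2) differentiable_on_eq_differentiable_at unfolding smooth_on_def by blast

lemma smooth_on_continuous: "smooth_on U f \<Longrightarrow> continuous_on U f"
  unfolding smooth_on_def using Ck_on.simps(1) by blast

lemma partial_component:
  assumes "f differentiable (at p)"
  shows "partial i (\<lambda>q. f q $ j) p = partial i f p $ j"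
proof -
  have "(f has_derivative frechet_derivative f (at p)) (at p)"
    using assms frechet_derivative_works by blast
  then have "((\<lambda>q. f q $ j) has_derivative (\<lambda>h. frechet_derivative f (at p) h $ j)) (at p)"
    by (rule bounded_linear.has_derivative[OF bounded_linear_vec_nth])
  from partial_eqI[OF this] show ?thesis by (simp add: partial_def)
qed

lemma smooth_on_component:
  fixes f :: "real^2 \<Rightarrow> real^2"
  assumes "smooth_on U f" "open U"
  shows "smooth_on U (\<lambda>p. f p $ j)"
proof -
  have "Ck_on n U f \<Longrightarrow> Ck_on n U (\<lambda>p. f p $ j)" for n
  proof (induction n arbitrary: f)
    case 0
    then show ?case by (auto intro: continuous_intros)
  next
    case (Suc n)
    then have d: "f differentiable (at p)" if "p \<in> U" for p
      using that assms(2) by (simp add: differentiable_on_eq_differentiable_at)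
    have "Ck_on n U (partial i (\<lambda>p. f p $ j))" for i
      using Ck_on_cong[OF assms(2), of "partial i (\<lambda>p. f p $ j)" "\<lambda>p. partial i f p $ j"]
        Suc d by (simp add: partial_component)
    moreover have "(\<lambda>p. f p $ j) differentiable_on U"
      using d bounded_linear.has_derivative[OF bounded_linear_vec_nth]
      by (auto simp: differentiable_on_eq_differentiable_at assms(2) differentiable_def) blast
    ultimately show ?case by simp
  qed
  then show ?thesis using assms(1) by (simp add: smooth_on_def)
qed

lemma partial_const [simp]: "partial i (\<lambda>p. k) = (\<lambda>p. 0)"
  using partial_eqI[OF has_derivative_const] by fastforce

lemma smooth_on_const: "smooth_on U (\<lambda>p. k)"
proof -
  have "Ck_on n U (\<lambda>p. k)" for n
    by (induction n arbitrary: k) auto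
  then show ?thesis by (simp add: smooth_on_def)
qed

text \<open>Transition maps of a quotient by translations are only piecewise translations, since the lattice
vector may jump from one component of the domain to another. Their derivative is the identity
everywhere, which is all that smoothness requires.\<close>

lemma smooth_on_local_translation:
  fixes F :: "real^2 \<Rightarrow> real^2"
  assumes "open U" and F: "\<And>p. p \<in> U \<Longrightarrow> (F has_derivative (\<lambda>h. h)) (at p)"
  shows "smooth_on U F"
  unfolding smooth_on_def
proof
  fix n
  have d: "F differentiable_on U"
    using F assms(1) by (auto simp: differentiable_on_eq_differentiable_at differentiable_def)
  show "Ck_on n U F"
  proof (cases n)
    case 0
    then show ?thesis using d by (simp add: differentiable_imp_continuous_on)
  next
    case (Suc m)
    have "Ck_on m U (partial i F)" for i
      using smooth_on_const[of U "axis i 1 :: real^2"] Ck_on_cong[OF assms(1), of "partial i F" "\<lambda>_. axis i 1"]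
      by (simp add: smooth_on_def partial_eqI[OF F])
    then show ?thesis using Suc d by simp
  qed
qed

lemma partial_of_first_coordinate:
  fixes u :: "real \<Rightarrow> real"
  assumes "(u has_real_derivative u') (at (p $ 1))"
  shows "partial 1 (\<lambda>q. u (q $ 1)) p = u'" "partial 2 (\<lambda>q. u (q $ 1)) p = 0"
    "(\<lambda>q. u (q $ 1)) differentiable (at p)"
proof -
  have "((\<lambda>q. u (q $ 1)) has_derivative (\<lambda>h. u' * h $ 1)) (at p)"
    using has_derivative_compose[OF bounded_linear_imp_has_derivative[OF bounded_linear_vec_nth]
        assms[unfolded has_field_derivative_def]] by simp
  from partial_eqI[OF this] this
  show "partial 1 (\<lambda>q. u (q $ 1)) p = u'" "partial 2 (\<lambda>q. u (q $ 1)) p = 0"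
    "(\<lambda>q. u (q $ 1)) differentiable (at p)"
    by (auto simp: axis_def differentiable_def)
qed

text \<open>This class of functions contains the squares of the warping functions and is closed under partial
derivatives, so that induction on the order of differentiability applies.\<close>

lemma smooth_on_sinusoid:
  "smooth_on U (\<lambda>p. a + b * sin (w * p $ 1) + d * cos (w * p $ 1))"
proof -
  have "Ck_on n UNIV (\<lambda>p. a + b * sin (w * p $ 1) + d * cos (w * p $ 1))" for n
  proof (induction n arbitrary: a b d)
    case 0
    show ?case by (auto intro!: continuous_intros)
  next
    case (Suc n)
    let ?u = "\<lambda>s. a + b * sin (w * s) + d * cos (w * s)"
    have u: "(?u has_real_derivative - d * w * sin (w * s) + b * w * cos (w * s)) (at s)" for s
      by (auto intro!: derivative_eq_intros)
    note p = partial_of_first_coordinate[OF u]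
    have "partial 1 (\<lambda>p. ?u (p $ 1)) = (\<lambda>p. 0 + (- d * w) * sin (w * p $ 1) + (b * w) * cos (w * p $ 1))"
      "partial 2 (\<lambda>p. ?u (p $ 1)) = (\<lambda>p. 0 + 0 * sin (w * p $ 1) + 0 * cos (w * p $ 1))"
      using p(1,2) by auto
    moreover have "(\<lambda>p::real^2. ?u (p $ 1)) differentiable_on UNIV"
      using p(3) by (auto simp: differentiable_on_def)
    ultimately show ?case
      unfolding Ck_on.simps forall_2 by (simp only: Suc simp_thms)
  qed
  then have "smooth_on UNIV (\<lambda>p. a + b * sin (w * p $ 1) + d * cos (w * p $ 1))"
    by (simp add: smooth_on_def)
  then show ?thesis by (rule smooth_on_subset) simp
qed

text \<open>Two applications of the mean value theorem, first along axis \<open>i\<close>, then along axis \<open>j\<close>. The left-hand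
side is symmetric in \<open>i\<close> and \<open>j\<close>, the right-hand side is not: this is what makes mixed partial
derivatives agree. The slack \<open>e\<close> keeps the whole square of side \<open>h\<close> strictly inside the ball on which
\<open>f\<close> is assumed to be differentiable.\<close>

lemma second_difference:
  fixes f :: "real^2 \<Rightarrow> real"
  assumes "0 < h" and f: "\<And>q. norm (q - p) < 2 * h + e \<Longrightarrow> f differentiable (at q)"
    and f': "\<And>q. norm (q - p) < 2 * h + e \<Longrightarrow> partial i f differentiable (at q)" and "0 < e"
  shows "\<exists>q. norm (q - p) \<le> 2 * h \<and>
    f (p + h *\<^sub>R axis i 1 + h *\<^sub>R axis j 1) - f (p + h *\<^sub>R axis i 1) - f (p + h *\<^sub>R axis j 1) + f p
      = h\<^sup>2 * partial j (partial i f) q"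
proof -
  have near: "norm (a *\<^sub>R axis i 1 + b *\<^sub>R axis j 1 :: real^2) \<le> 2 * h"
    if "0 \<le> a" "a \<le> h" "0 \<le> b" "b \<le> h" for a b
    using that norm_triangle_ineq[of "a *\<^sub>R axis i 1" "b *\<^sub>R axis j 1 :: real^2"] by simp
  let ?g = "\<lambda>t. f ((p + h *\<^sub>R axis j 1) + t *\<^sub>R axis i 1) - f (p + t *\<^sub>R axis i 1)"
  let ?g' = "\<lambda>t. partial i f ((p + h *\<^sub>R axis j 1) + t *\<^sub>R axis i 1) - partial i f (p + t *\<^sub>R axis i 1)"
  have "(?g has_real_derivative ?g' t) (at t)" if "0 \<le> t" "t \<le> h" for t
    using near[of t h] near[of t 0] that assms
    by (intro DERIV_diff DERIV_partial f) (auto simp: algebra_simps)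
  from MVT2[OF \<open>0 < h\<close> this] obtain x where x: "0 < x" "x < h" "?g h - ?g 0 = h * ?g' x" by auto
  have "((\<lambda>t. partial i f ((p + x *\<^sub>R axis i 1) + t *\<^sub>R axis j 1)) has_real_derivative
      partial j (partial i f) ((p + x *\<^sub>R axis i 1) + t *\<^sub>R axis j 1)) (at t)" if "0 \<le> t" "t \<le> h" for t
    using near[of x t] that x assms
    by (intro DERIV_partial f') (auto simp: algebra_simps)
  from MVT2[OF \<open>0 < h\<close> this] obtain y where y: "0 < y" "y < h"
    "partial i f ((p + x *\<^sub>R axis i 1) + h *\<^sub>R axis j 1) - partial i f (p + x *\<^sub>R axis i 1)
      = h * partial j (partial i f) ((p + x *\<^sub>R axis i 1) + y *\<^sub>R axis j 1)" by auto
  show ?thesis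
    using x y near[of x y]
    by (intro exI[of _ "(p + x *\<^sub>R axis i 1) + y *\<^sub>R axis j 1"])
      (auto simp: algebra_simps power2_eq_square)
qed

text \<open>If the two mixed derivatives differed at \<open>p\<close>, continuity would keep them apart on a small ball around
\<open>p\<close>, while the second difference gives points of that ball at which they take the same value.\<close>

lemma partial_commute:
  fixes f :: "real^2 \<Rightarrow> real"
  assumes sm: "smooth_on U f" and U: "open U" "p \<in> U"
  shows "partial i (partial j f) p = partial j (partial i f) p"
proof (rule ccontr)
  assume ne: "partial i (partial j f) p \<noteq> partial j (partial i f) p"
  define e where "e = \<bar>partial i (partial j f) p - partial j (partial i f) p\<bar> / 2"
  have "e > 0" using ne by (simp add: e_def)
  have "isCont (partial i (partial j f)) p" "isCont (partial j (partial i f)) p"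
    using smooth_on_continuous[OF smooth_on_partial[OF smooth_on_partial[OF sm]]] U
    by (auto simp: continuous_on_eq_continuous_at)
  then obtain d1 d2 where d: "d1 > 0" "d2 > 0"
     "\<And>q. norm (q - p) < d1 \<Longrightarrow> \<bar>partial i (partial j f) q - partial i (partial j f) p\<bar> < e"
     "\<And>q. norm (q - p) < d2 \<Longrightarrow> \<bar>partial j (partial i f) q - partial j (partial i f) p\<bar> < e"
    using \<open>e > 0\<close> unfolding continuous_at_eps_delta dist_norm real_norm_def by metis
  obtain d3 where d3: "d3 > 0" "\<And>q. norm (q - p) < d3 \<Longrightarrow> q \<in> U"
    using U by (metis dist_norm open_dist)
  define h where "h = min d1 (min d2 d3) / 3"
  have h: "h > 0" "2 * h + h \<le> d1" "2 * h + h \<le> d2" "2 * h + h \<le> d3" using d d3 by (auto simp: h_def)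
  have df: "f differentiable (at q)" "partial k f differentiable (at q)" if "norm (q - p) < 2 * h + h" for q k
    using smooth_on_differentiable[OF sm U(1)] smooth_on_differentiable[OF smooth_on_partial[OF sm] U(1)]
      d3(2) that h by auto
  obtain q where q: "norm (q - p) \<le> 2 * h"
    "f (p + h *\<^sub>R axis i 1 + h *\<^sub>R axis j 1) - f (p + h *\<^sub>R axis i 1) - f (p + h *\<^sub>R axis j 1) + f p
      = h\<^sup>2 * partial j (partial i f) q" using second_difference[OF h(1) df h(1), where i = i and j = j] by auto
  obtain q' where q': "norm (q' - p) \<le> 2 * h"
    "f (p + h *\<^sub>R axis j 1 + h *\<^sub>R axis i 1) - f (p + h *\<^sub>R axis j 1) - f (p + h *\<^sub>R axis i 1) + f p
      = h\<^sup>2 * partial i (partial j f) q'" using second_difference[OF h(1) df h(1), where i = j and j = i] by auto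
  have "h\<^sup>2 * partial j (partial i f) q = h\<^sup>2 * partial i (partial j f) q'"
    using q(2) q'(2) by (simp add: algebra_simps)
  then have "partial j (partial i f) q = partial i (partial j f) q'" using h(1) by simp
  moreover have "\<bar>partial i (partial j f) q' - partial i (partial j f) p\<bar> < e"
    "\<bar>partial j (partial i f) q - partial j (partial i f) p\<bar> < e"
    using d(3)[of q'] d(4)[of q] q(1) q'(1) h by auto
  ultimately show False by (simp add: e_def abs_if split: if_splits)
qed

section \<open>Curvature of warped metrics on the plane\<close>

abbreviation diag2 :: "real \<Rightarrow> real^2^2" where
  "diag2 b \<equiv> vector [vector [1, 0], vector [0, b]]"

lemma matrix_inv_diag2:
  assumes "b \<noteq> 0"
  shows "matrix_inv (diag2 b) = diag2 (1 / b)"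
proof -
  have 1: "diag2 b ** diag2 (1 / b) = mat 1" "diag2 (1 / b) ** diag2 b = mat 1"
    using assms by (simp_all add: vec_eq_iff forall_2 matrix_matrix_mult_def sum_2 mat_def)
  then have "diag2 b ** matrix_inv (diag2 b) = mat 1"
    unfolding matrix_inv_def by (metis (mono_tags, lifting) someI_ex)
  then have "diag2 (1 / b) ** (diag2 b ** matrix_inv (diag2 b)) = diag2 (1 / b)" by simp
  then show ?thesis using 1 by (simp add: matrix_mul_assoc)
qed

locale warped_plane =
  fixes f f' f'' :: "real \<Rightarrow> real"
  assumes pos: "\<And>s. f s > 0"
    and f': "\<And>s. (f has_real_derivative f' s) (at s)"
    and f'': "\<And>s. (f' has_real_derivative f'' s) (at s)"
begin

abbreviation "G \<equiv> (\<lambda>p :: real^2. diag2 ((f (p $ 1))\<^sup>2))"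

lemma nz: "f s \<noteq> 0"
  using pos[of s] by simp

lemma partial_G_22: "partial 1 (\<lambda>q. (f (q $ 1))\<^sup>2) p = 2 * f (p $ 1) * f' (p $ 1)"
   "partial 2 (\<lambda>q. (f (q $ 1))\<^sup>2) p = 0"
proof -
  have "((\<lambda>s. (f s)\<^sup>2) has_real_derivative 2 * f s * f' s) (at s)" for s
    by (auto intro!: derivative_eq_intros f')
  from partial_of_first_coordinate(1,2)[OF this] show "partial 1 (\<lambda>q. (f (q $ 1))\<^sup>2) p = 2 * f (p $ 1) * f' (p $ 1)"
   "partial 2 (\<lambda>q. (f (q $ 1))\<^sup>2) p = 0" by auto
qed

lemma christoffel_warped:
  "christoffel G 1 1 1 p = 0" "christoffel G 1 1 2 p = 0" "christoffel G 1 2 1 p = 0"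
  "christoffel G 1 2 2 p = - f (p $ 1) * f' (p $ 1)"
  "christoffel G 2 1 1 p = 0" "christoffel G 2 1 2 p = f' (p $ 1) / f (p $ 1)"
  "christoffel G 2 2 1 p = f' (p $ 1) / f (p $ 1)" "christoffel G 2 2 2 p = 0"
  using nz by (simp_all add: christoffel_def sum_2 matrix_inv_diag2 partial_G_22) (simp_all add: power2_eq_square)

lemma gauss_curvature_warped: "gauss_curvature G = (\<lambda>p. - f'' (p $ 1) / f (p $ 1))"
proof
  fix p :: "real^2"
  let ?s = "p $ 1"
  have c: "christoffel G 1 2 2 = (\<lambda>q. - f (q $ 1) * f' (q $ 1))"
     "christoffel G 1 1 2 = (\<lambda>q. 0)"
    using christoffel_warped by auto
  have "((\<lambda>s. - f s * f' s) has_real_derivative - (f' s)\<^sup>2 - f s * f'' s) (at s)" for s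
    by (auto intro!: derivative_eq_intros f' f'' simp: power2_eq_square)
  from partial_of_first_coordinate(1)[OF this]
  have "riemann_122 G 1 p = - f ?s * f'' ?s"
    unfolding riemann_122_def c
    using nz[of ?s] by (simp add: sum_2 christoffel_warped) (simp add: power2_eq_square)
  then show "gauss_curvature G p = - f'' (p $ 1) / f (p $ 1)"
    using nz[of ?s] by (simp add: gauss_curvature_def sum_2 det_2 power2_eq_square)
qed

lemma gradient_warped:
  assumes "\<And>s. (k has_real_derivative k' s) (at s)"
  shows "gradient G (\<lambda>p. k (p $ 1)) = (\<lambda>p. vector [k' (p $ 1), 0])"
proof
  fix p :: "real^2"
  show "gradient G (\<lambda>p. k (p $ 1)) p = vector [k' (p $ 1), 0]"
    using nz[of "p $ 1"] partial_of_first_coordinate(1,2)[OF assms]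
    by (simp add: gradient_def matrix_inv_diag2 vec_eq_iff forall_2 matrix_vector_mult_def sum_2)
qed

lemma laplace_beltrami_warped:
  assumes k: "\<And>s. (k has_real_derivative k' s) (at s)" "\<And>s. (k' has_real_derivative k'' s) (at s)"
  shows "laplace_beltrami G (\<lambda>p. k (p $ 1)) p = k'' (p $ 1) + f' (p $ 1) / f (p $ 1) * k' (p $ 1)"
proof -
  have d: "sqrt (det (G q)) = f (q $ 1)" for q
    using pos[of "q $ 1"] by (simp add: det_2)
  have "((\<lambda>s. f s * k' s) has_real_derivative f' s * k' s + f s * k'' s) (at s)" for s
    by (auto intro!: derivative_eq_intros f' k(2))
  from partial_of_first_coordinate(1)[OF this] show ?thesis
    using nz[of "p $ 1"] unfolding laplace_beltrami_def sum_2 d gradient_warped[OF k(1)]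
    by (simp add: field_simps)
qed

lemma norm_sq_gradient_warped:
  assumes k: "\<And>s. (k has_real_derivative k' s) (at s)"
  shows "norm_sq G (gradient G (\<lambda>p. k (p $ 1))) p = (k' (p $ 1))\<^sup>2"
  unfolding norm_sq_def gradient_warped[OF k]
  by (simp add: inner_vec_def sum_2 matrix_vector_mult_def power2_eq_square)

text \<open>Where \<open>K \<noteq> c\<close>, division by \<open>(K - c)\<^sup>2\<close> turns the Ricci equation into \<open>\<Delta> log \<bar>K - c\<bar> = 4 K\<close>. The hypothesis
says that \<open>K - c\<close> is a constant multiple of \<open>f\<^sup>-\<^sup>4\<close>, and \<open>\<Delta> log f = f'' / f = - K\<close> for every warped
metric. The proof verifies the undivided form with the resulting radial derivatives of \<open>K\<close>.\<close>

lemma spherical_ricci_warped: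
  assumes ode: "\<And>s. f'' s / f s = - c + m / f s ^ 4"
  defines "K \<equiv> gauss_curvature G"
  shows "(K p - c) * laplace_beltrami G K p - norm_sq G (gradient G K) p - 4 * K p * (K p - c)^2 = 0"
proof -
  define k k' k'' where "k s = c - m / f s ^ 4" and "k' s = 4 * m * f' s / f s ^ 5"
    and "k'' s = 4 * m * f'' s / f s ^ 5 - 20 * m * (f' s)\<^sup>2 / f s ^ 6" for s
  have K: "K = (\<lambda>p. k (p $ 1))"
    unfolding K_def gauss_curvature_warped using ode by (auto simp: k_def)
  have k: "(k has_real_derivative k' s) (at s)" "(k' has_real_derivative k'' s) (at s)" for s
    unfolding k_def[abs_def] k'_def[abs_def] k''_def 
    using nz[of s] by (auto intro!: derivative_eq_intros f' f'' simp: field_simps power_def numeral_eq_Suc power2_eq_square)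
  let ?s = "p $ 1"
  have f2: "f'' ?s = (- c + m / f ?s ^ 4) * f ?s"
    using ode[of ?s] nz[of ?s] by (simp add: field_simps)
  show ?thesis
    unfolding K norm_sq_gradient_warped[OF k(1)] laplace_beltrami_warped[OF k]
    unfolding k_def k'_def k''_def f2
    using nz[of ?s] by (simp add: field_simps) (simp add: algebra_simps power_def numeral_eq_Suc power2_eq_square)
qed

end

section \<open>Local isometries between warped metrics\<close>

text \<open>Differentiability along a coordinate line only, so that the one-variable derivative rules compute
the partial derivatives of products and compositions without any smoothness of these.\<close>

definition has_partial :: "2 \<Rightarrow> (real^2 \<Rightarrow> real) \<Rightarrow> real^2 \<Rightarrow> real \<Rightarrow> bool" where
  "has_partial i g p d \<longleftrightarrow> ((\<lambda>t. g (p + t *\<^sub>R axis i 1)) has_real_derivative d) (at 0)"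

lemma has_partial_smooth:
  assumes "smooth_on U g" "open U" "p \<in> U"
  shows "has_partial i g p (partial i g p)"
  using DERIV_partial[of g p 0 i] smooth_on_differentiable[OF assms] by (simp add: has_partial_def)

lemma has_partial_const: "has_partial i (\<lambda>q. k) p 0"
  by (simp add: has_partial_def)

lemma has_partial_diff: "has_partial i f p x \<Longrightarrow> has_partial i g p y \<Longrightarrow> has_partial i (\<lambda>q. f q - g q) p (x - y)"
  unfolding has_partial_def by (rule DERIV_diff)

lemma has_partial_add: "has_partial i f p x \<Longrightarrow> has_partial i g p y \<Longrightarrow> has_partial i (\<lambda>q. f q + g q) p (x + y)"
  unfolding has_partial_def by (rule DERIV_add)

lemma has_partial_mult: "has_partial i f p x \<Longrightarrow> has_partial i g p y \<Longrightarrow> has_partial i (\<lambda>q. f q * g q) p (x * g p + y * f p)"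
  unfolding has_partial_def by (drule (1) DERIV_mult) simp

lemma has_partial_compose:
  "(k has_real_derivative k') (at (g p)) \<Longrightarrow> has_partial i g p x \<Longrightarrow> has_partial i (\<lambda>q. k (g q)) p (k' * x)"
  unfolding has_partial_def by (rule DERIV_chain2) simp_all

lemma has_partial_coordinate: "has_partial 1 (\<lambda>q. q $ 1) p 1" "has_partial 2 (\<lambda>q. q $ 1) p 0"
  by (auto simp: has_partial_def axis_def intro!: derivative_eq_intros)

text \<open>This is the rule by which an identity between functions on an open set is differentiated.\<close>

lemma has_partial_unique_on:
  assumes "has_partial i f p x" "has_partial i g p y" "open U" "p \<in> U" "\<And>q. q \<in> U \<Longrightarrow> f q = g q"
  shows "x = y"
proof -
  let ?S = "(\<lambda>t. p + t *\<^sub>R axis i 1) -` U"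
  have "open ?S"
    by (intro open_vimage assms(3) continuous_intros)
  moreover have "0 \<in> ?S" using assms(4) by simp
  ultimately have ev: "\<forall>\<^sub>F t in nhds 0. f (p + t *\<^sub>R axis i 1) = g (p + t *\<^sub>R axis i 1)"
    unfolding eventually_nhds by (intro exI[of _ ?S]) (simp add: assms(5))
  have "((\<lambda>t. g (p + t *\<^sub>R axis i 1)) has_real_derivative x) (at 0)"
    using assms(1) DERIV_cong_ev[OF refl ev refl, of x] by (simp only: has_partial_def)
  then show ?thesis
    using assms(2) DERIV_unique[of _ x 0 y] by (simp only: has_partial_def)
qed

lemma (in warped_plane) log_derivative:
  "((\<lambda>s. f' s / f s) has_real_derivative f'' s / f s - (f' s / f s)\<^sup>2) (at s)"
proof -
  have "(f'' s * f s - f' s * f' s) / (f s * f s) = f'' s / f s - (f' s / f s)\<^sup>2"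
    using nz[of s] by (simp add: diff_divide_distrib power2_eq_square)
  then show ?thesis using DERIV_divide[OF f'' f' nz, of s] by simp
qed

lemma jacobian_entry:
  assumes "\<psi> differentiable (at p)"
  shows "jacobian \<psi> (at p) $ i $ j = partial j (\<lambda>q. \<psi> q $ i) p"
  unfolding partial_component[OF assms] by (simp add: jacobian_def matrix_def partial_def)

text \<open>The hypotheses say that the matrix with rows \<open>(a, b)\<close> and \<open>(v, w)\<close> pulls \<open>diag(1, y\<^sup>2)\<close> back to
\<open>diag(1, x\<^sup>2)\<close>. With respect to orthonormal frames it is orthogonal, hence a rotation (\<open>e = 1\<close>)
or a reflection (\<open>e = - 1\<close>), and its first row determines the second one up to the sign \<open>e\<close>.\<close>

lemma orthonormal_columns:
  fixes a b v w x y e :: real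
  assumes "1 = a * a + v * v * y\<^sup>2" "0 = a * b + v * w * y\<^sup>2" "x\<^sup>2 = b * b + w * w * y\<^sup>2"
    and "x > 0" "y > 0"
  shows "((a * w - b * v) * y)\<^sup>2 = x\<^sup>2"
    and "(a * w - b * v) * y = e * x \<Longrightarrow> e\<^sup>2 = 1 \<Longrightarrow>
           v * x * y = - e * b \<and> w * y = e * a * x \<and> a\<^sup>2 * x\<^sup>2 + b\<^sup>2 = x\<^sup>2"
proof -
  show "((a * w - b * v) * y)\<^sup>2 = x\<^sup>2" using assms(1-3) by algebra
  assume e: "(a * w - b * v) * y = e * x" "e\<^sup>2 = 1"
  have 1: "v * y * (e * x) = - b" unfolding e(1)[symmetric] using assms(1,2) by algebra
  have 2: "w * y * (e * x) = a * x\<^sup>2" unfolding e(1)[symmetric] using assms(2,3) by algebra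
  have "x * (w * y - e * a * x) = 0" using 2 e(2) by algebra
  then have 3: "w * y = e * a * x" using assms(4) by simp
  have 4: "v * x * y = - e * b" using 1 e(2) by algebra
  have "a\<^sup>2 * x\<^sup>2 + b\<^sup>2 = x\<^sup>2" using 1 e(2) assms(1) by algebra
  then show "v * x * y = - e * b \<and> w * y = e * a * x \<and> a\<^sup>2 * x\<^sup>2 + b\<^sup>2 = x\<^sup>2"
    by (intro conjI 3 4)
qed

text \<open>Invariance of the Gaussian curvature, in the only case needed. Write \<open>\<psi> = (u, v)\<close>. The function \<open>u\<close>
satisfies \<open>|\<nabla>u| = 1\<close> and \<open>\<Delta>u = g(u)\<close> with \<open>g = f\<^sub>2' / f\<^sub>2\<close>, because the first coordinate has these
properties for the target metric; here the equation for \<open>\<Delta>u\<close> comes from \<open>\<partial>\<^sub>1\<partial>\<^sub>2 v = \<partial>\<^sub>2\<partial>\<^sub>1 v\<close>. As \<open>\<nabla>u\<close> lies in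
the kernel of the Hessian of \<open>u\<close>, these equations determine all second derivatives of \<open>u\<close>. Their
integrability conditions, equivalent to Bochner's formula
\<open>0 = |Hess u|\<^sup>2 + \<langle>\<nabla>u, \<nabla>\<Delta>u\<rangle> + K\<^sub>1 |\<nabla>u|\<^sup>2 = g(u)\<^sup>2 + g'(u) + K\<^sub>1\<close>, give
\<open>- K\<^sub>1 = g'(u) + g(u)\<^sup>2 = f\<^sub>2''(u) / f\<^sub>2(u)\<close>. The equation for \<open>\<Delta>u\<close> comes out the same
for both orientations, because the sign \<open>e\<close> of the Jacobian determinant is constant near \<open>p\<close>.\<close>

lemma local_isometry_curvature:
  assumes W1: "warped_plane f1 f1' f1''" and W2: "warped_plane f2 f2' f2''"
    and U0: "open U\<^sub>0" "p \<in> U\<^sub>0" and \<psi>: "smooth_on U\<^sub>0 \<psi>"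
    and iso: "\<And>q. q \<in> U\<^sub>0 \<Longrightarrow> diag2 ((f1 (q $ 1))\<^sup>2) =
       transpose (jacobian \<psi> (at q)) ** diag2 ((f2 (\<psi> q $ 1))\<^sup>2) ** jacobian \<psi> (at q)"
  shows "f1'' (p $ 1) / f1 (p $ 1) = f2'' (\<psi> p $ 1) / f2 (\<psi> p $ 1)"
proof -
  interpret W1: warped_plane f1 f1' f1'' by fact
  interpret W2: warped_plane f2 f2' f2'' by fact
  define u v where "u q = \<psi> q $ 1" and "v q = \<psi> q $ 2" for q
  have sm0: "smooth_on U\<^sub>0 u" "smooth_on U\<^sub>0 v"
    using smooth_on_component[OF \<psi> U0(1)] by (simp_all add: u_def[abs_def] v_def[abs_def])
  define a b v1 v2 where "a = partial 1 u" and "b = partial 2 u" and "v1 = partial 1 v" and "v2 = partial 2 v"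
  have J: "jacobian \<psi> (at q) = vector [vector [a q, b q], vector [v1 q, v2 q]]" if "q \<in> U\<^sub>0" for q
    using jacobian_entry[OF smooth_on_differentiable[OF \<psi> U0(1) that]]
    by (simp add: vec_eq_iff forall_2 a_def b_def v1_def v2_def u_def[abs_def] v_def[abs_def])
  have onb: "1 = a q * a q + v1 q * v1 q * (f2 (u q))\<^sup>2"
    "0 = a q * b q + v1 q * v2 q * (f2 (u q))\<^sup>2"
    "(f1 (q $ 1))\<^sup>2 = b q * b q + v2 q * v2 q * (f2 (u q))\<^sup>2" if "q \<in> U\<^sub>0" for q
    using iso[OF that] unfolding J[OF that]
    by (simp_all add: vec_eq_iff forall_2 matrix_matrix_mult_def transpose_def sum_2 u_def algebra_simps)
  define d where "d q = a q * v2 q - b q * v1 q" for q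
  have d2: "(d q * f2 (u q))\<^sup>2 = (f1 (q $ 1))\<^sup>2" if "q \<in> U\<^sub>0" for q
    using orthonormal_columns(1)[OF onb[OF that] W1.pos W2.pos] by (simp add: d_def)
  define e where "e = sgn (d p)"
  have "d p \<noteq> 0" using d2[OF U0(2)] W1.nz[of "p $ 1"] by auto
  then have e: "e\<^sup>2 = 1" "d p * e > 0" by (auto simp: e_def sgn_if)
  \<comment> \<open>A neighbourhood of \<open>p\<close> on which the Jacobian determinant \<open>d\<close> keeps its sign \<open>e\<close>.\<close>
  define U where "U = {q \<in> U\<^sub>0. 0 < d q * e}"
  have "continuous_on U\<^sub>0 (\<lambda>q. d q * e)"
    using smooth_on_continuous[OF smooth_on_partial[OF sm0(1)]] smooth_on_continuous[OF smooth_on_partial[OF sm0(2)]]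
    unfolding d_def a_def b_def v1_def v2_def by (intro continuous_intros)
  from continuous_open_preimage[OF this U0(1) open_greaterThan[of 0]]
  have U: "open U" "p \<in> U" "U \<subseteq> U\<^sub>0"
    using U0 e(2) by (auto simp: U_def vimage_def Int_def)
  have sm: "smooth_on U u" "smooth_on U v" "smooth_on U a" "smooth_on U b" "smooth_on U v1" "smooth_on U v2"
    using smooth_on_subset[OF sm0(1) U(3)] smooth_on_subset[OF sm0(2) U(3)]
    by (auto simp: a_def b_def v1_def v2_def intro: smooth_on_partial)
  have "d q * f2 (u q) = e * f1 (q $ 1)" if "q \<in> U" for q
  proof -
    have "(e * d q * f2 (u q))\<^sup>2 = (f1 (q $ 1))\<^sup>2" using d2[of q] that e(1) by (auto simp: U_def power_mult_distrib)
    moreover have "e * d q * f2 (u q) > 0" using that W2.pos[of "u q"] by (simp add: U_def mult.commute)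
    ultimately have "e * d q * f2 (u q) = f1 (q $ 1)"
      using W1.pos[of "q $ 1"] by (simp add: power2_eq_iff)
    then show ?thesis using e(1) by (auto simp: power2_eq_1_iff)
  qed
  then have frame: "v1 q * f1 (q $ 1) * f2 (u q) = - e * b q" "v2 q * f2 (u q) = e * a q * f1 (q $ 1)"
    "(a q)\<^sup>2 * (f1 (q $ 1))\<^sup>2 + (b q)\<^sup>2 = (f1 (q $ 1))\<^sup>2" if "q \<in> U" for q
    using orthonormal_columns(2)[OF onb W1.pos W2.pos, of q e] that U(3) e(1) by (auto simp: d_def)
  define g where "g s = f2' s / f2 s" for s
  define k where "k s = f1' s / f1 s" for s
  have g': "(g has_real_derivative f2'' s / f2 s - (g s)\<^sup>2) (at s)" for s
    using W2.log_derivative unfolding g_def by simp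
  have k': "(k has_real_derivative f1'' s / f1 s - (k s)\<^sup>2) (at s)" for s
    using W1.log_derivative unfolding k_def by simp
  have b1: "partial 1 b q = partial 2 a q" if "q \<in> U" for q
    using partial_commute[OF sm(1) U(1) that] by (simp add: a_def b_def)
  have v21: "partial 1 v2 q = partial 2 v1 q" if "q \<in> U" for q
    using partial_commute[OF sm(2) U(1) that] by (simp add: v1_def v2_def)
  note ds = has_partial_smooth[OF _ U(1)]
  have du: "has_partial 1 u q (a q)" "has_partial 2 u q (b q)" if "q \<in> U" for q
    using ds[OF sm(1) that] by (simp_all add: a_def b_def)
  \<comment> \<open>The Hessian of \<open>u\<close>, with \<open>\<partial>\<^sub>1 b = \<partial>\<^sub>2 a\<close> as its off-diagonal entry.\<close>
  have hess: "partial 1 a q * (f1 (q $ 1))\<^sup>2 = (b q)\<^sup>2 * g (u q)"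
    "partial 2 a q = b q * (k (q $ 1) - a q * g (u q))"
    "partial 2 b q = (f1 (q $ 1))\<^sup>2 * ((a q)\<^sup>2 * g (u q) - a q * k (q $ 1))" if q: "q \<in> U" for q
  proof -
    note pf1 = has_partial_compose[OF W1.f' has_partial_coordinate(1)] has_partial_compose[OF W1.f' has_partial_coordinate(2)]
    note pf2 = has_partial_compose[OF W2.f' du(1)[OF q]] has_partial_compose[OF W2.f' du(2)[OF q]]
    let ?s = "q $ 1"
    have k: "f1' ?s = k ?s * f1 ?s" using W1.nz[of ?s] by (simp add: k_def)
    have g: "f2' (u q) = g (u q) * f2 (u q)" using W2.nz[of "u q"] by (simp add: g_def)
    have E: "x = y" if "has_partial i (\<lambda>q. (a q * a q) * (f1 (q $ 1) * f1 (q $ 1)) + b q * b q) q x"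
       "has_partial i (\<lambda>q. f1 (q $ 1) * f1 (q $ 1)) q y" for i x y
      by (rule has_partial_unique_on[OF that U(1) q]) (use frame(3) in \<open>simp add: power2_eq_square\<close>)
    note E1 = E[OF has_partial_add[OF has_partial_mult[OF has_partial_mult[OF ds[OF sm(3) q] ds[OF sm(3) q]]
            has_partial_mult[OF pf1(1) pf1(1)]] has_partial_mult[OF ds[OF sm(4) q] ds[OF sm(4) q]]]
          has_partial_mult[OF pf1(1) pf1(1)]]
    note E2 = E[OF has_partial_add[OF has_partial_mult[OF has_partial_mult[OF ds[OF sm(3) q] ds[OF sm(3) q]]
            has_partial_mult[OF pf1(2) pf1(2)]] has_partial_mult[OF ds[OF sm(4) q] ds[OF sm(4) q]]]
          has_partial_mult[OF pf1(2) pf1(2)]]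
    note E3 = has_partial_unique_on[OF has_partial_mult[OF has_partial_mult[OF ds[OF sm(5) q] pf1(2)] pf2(2)]
         has_partial_mult[OF has_partial_const ds[OF sm(4) q]] U(1) q frame(1)]
    note E4 = has_partial_unique_on[OF has_partial_mult[OF ds[OF sm(6) q] pf2(1)]
         has_partial_mult[OF has_partial_mult[OF has_partial_const ds[OF sm(3) q]] pf1(1)] U(1) q frame(2)]
    define A B C x y V where "A = partial 1 a q" and "B = partial 2 a q" and "C = partial 2 b q" 
      and "x = f1 ?s" and "y = f2 (u q)" and "V = partial 2 v1 q"
    have x: "x > 0" "y > 0" using W1.pos W2.pos by (auto simp: x_def y_def)
    have F: "v1 q * x * y = - e * b q" "v2 q * y = e * a q * x" "(a q)\<^sup>2 * x\<^sup>2 + (b q)\<^sup>2 = x\<^sup>2"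
      using frame[OF q] by (simp_all add: x_def y_def)
    \<comment> \<open>Derivatives of \<open>|\<nabla>u| = 1\<close> along the two axes.\<close>
    have e1: "a q * A * x\<^sup>2 + b q * B = (1 - (a q)\<^sup>2) * k ?s * x\<^sup>2"
      using E1 unfolding b1[OF q] k by (simp add: A_def B_def x_def algebra_simps power2_eq_square)
    have e2: "a q * B * x\<^sup>2 + b q * C = 0"
      using E2 by (simp add: B_def C_def x_def algebra_simps power2_eq_square)
    \<comment> \<open>The two expressions of \<open>V = \<partial>\<^sub>2\<partial>\<^sub>1 v\<close>; eliminating \<open>V\<close> gives \<open>e5\<close>, which is \<open>x\<^sup>2 \<Delta>u = x\<^sup>2 g(u)\<close>.\<close>
    have e3: "V * x * y + v1 q * x * y * g (u q) * b q = - e * C"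
      using E3 unfolding g by (simp add: V_def C_def x_def y_def algebra_simps power2_eq_square)
    have e4: "V * y + v2 q * y * g (u q) * a q = e * A * x + e * a q * k ?s * x"
      using E4 unfolding g k v21[OF q] by (simp add: V_def A_def x_def y_def algebra_simps power2_eq_square)
    have "V * x * y = e * b q * g (u q) * b q - e * C"
      using e3 unfolding F(1) by (simp add: algebra_simps)
    moreover have "V * y = e * A * x + e * a q * k ?s * x - e * a q * x * g (u q) * a q"
      using e4 unfolding F(2) by (simp add: algebra_simps)
    ultimately have "e * (x\<^sup>2 * A + a q * k ?s * x\<^sup>2 - (a q)\<^sup>2 * x\<^sup>2 * g (u q)) = e * ((b q)\<^sup>2 * g (u q) - C)"
      by algebra
    then have "x\<^sup>2 * A + a q * k ?s * x\<^sup>2 - (a q)\<^sup>2 * x\<^sup>2 * g (u q) = (b q)\<^sup>2 * g (u q) - C"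
      using e(1) by auto
    then have e5: "C + x\<^sup>2 * A + a q * k ?s * x\<^sup>2 = g (u q) * x\<^sup>2"
      using F(3) by algebra
    have "x\<^sup>2 * (A * x\<^sup>2 - (b q)\<^sup>2 * g (u q)) = 0" using e1 e2 e5 F(3) by algebra
    then have r1: "A * x\<^sup>2 = (b q)\<^sup>2 * g (u q)" using x by simp
    have "x\<^sup>2 * (B - b q * (k ?s - a q * g (u q))) = 0" using e1 e2 e5 F(3) by algebra
    then have r2: "B = b q * (k ?s - a q * g (u q))" using x by simp
    have r3: "C = x\<^sup>2 * ((a q)\<^sup>2 * g (u q) - a q * k ?s)" using e5 r1 F(3) by algebra
    show "partial 1 a q * (f1 (q $ 1))\<^sup>2 = (b q)\<^sup>2 * g (u q)"
      "partial 2 a q = b q * (k (q $ 1) - a q * g (u q))"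
      "partial 2 b q = (f1 (q $ 1))\<^sup>2 * ((a q)\<^sup>2 * g (u q) - a q * k (q $ 1))"
      using r1 r2 r3 by (simp_all add: A_def B_def C_def x_def)
  qed
  note sa = sm(3) and sb = sm(4)
  note pg = has_partial_compose[OF g' du(1)[OF U(2)]] has_partial_compose[OF g' du(2)[OF U(2)]]
  note pk = has_partial_compose[OF k' has_partial_coordinate(1)] has_partial_compose[OF k' has_partial_coordinate(2)]
  note pf1 = has_partial_compose[OF W1.f' has_partial_coordinate(1)] has_partial_compose[OF W1.f' has_partial_coordinate(2)]
  note da = ds[OF sm(3) U(2)] note db = ds[OF sm(4) U(2)]
  have E1: "x = y" if "has_partial 2 (\<lambda>q. partial 1 a q * (f1 (q $ 1) * f1 (q $ 1))) p x"
       "has_partial 2 (\<lambda>q. (b q * b q) * g (u q)) p y" for x y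
    by (rule has_partial_unique_on[OF that U(1) U(2)]) (use hess(1) in \<open>simp add: power2_eq_square\<close>)
  have E2: "x = y" if "has_partial i (\<lambda>q. partial 2 a q) p x"
       "has_partial i (\<lambda>q. b q * (k (q $ 1) - a q * g (u q))) p y" for x y i
    by (rule has_partial_unique_on[OF that U(1) U(2)]) (rule hess(2))
  have E3: "x = y" if "has_partial 1 (\<lambda>q. partial 2 b q) p x"
       "has_partial 1 (\<lambda>q. (f1 (q $ 1) * f1 (q $ 1)) * (a q * a q * g (u q) - a q * k (q $ 1))) p y" for x y
    by (rule has_partial_unique_on[OF that U(1) U(2)]) (use hess(3) in \<open>simp add: power2_eq_square\<close>)
  note D1 = E1[OF has_partial_mult[OF ds[OF smooth_on_partial[OF sa] U(2)] has_partial_mult[OF pf1(2) pf1(2)]]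
      has_partial_mult[OF has_partial_mult[OF db db] pg(2)]]
  note D2 = E2[OF ds[OF smooth_on_partial[OF sa] U(2)] has_partial_mult[OF db has_partial_diff[OF pk(1) has_partial_mult[OF da pg(1)]]]]
    E2[OF ds[OF smooth_on_partial[OF sa] U(2)] has_partial_mult[OF db has_partial_diff[OF pk(2) has_partial_mult[OF da pg(2)]]]]
  note D3 = E3[OF ds[OF smooth_on_partial[OF sb] U(2)] has_partial_mult[OF has_partial_mult[OF pf1(1) pf1(1)] 
     has_partial_diff[OF has_partial_mult[OF has_partial_mult[OF da da] pg(1)] has_partial_mult[OF da pk(1)]]]]
  let ?s = "p $ 1"
  have kp: "f1' ?s = k ?s * f1 ?s" using W1.nz[of ?s] by (simp add: k_def)
  define A B C x c1 c2 P Q where "A = partial 1 a p" and "B = partial 2 a p" and "C = partial 2 b p" 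
      and "x = f1 ?s" and "c1 = f1'' ?s / f1 ?s" and "c2 = f2'' (u p) / f2 (u p)"
      and "P = partial 1 (partial 2 a) p" and "Q = partial 2 (partial 2 a) p"
  have x: "x > 0" using W1.pos by (simp add: x_def)
  note h = hess[OF U(2), folded A_def B_def C_def x_def]
  have P: "partial 2 (partial 1 a) p = P"
    using partial_commute[OF sa U(1,2)] by (simp add: P_def)
  have Q: "partial 1 (partial 2 b) p = Q"
    using partial_commute[OF sb U(1,2), where i = 1 and j = 2] partial_cong_open[OF U(1,2) b1, where i = 2] by (simp add: Q_def)
  \<comment> \<open>Integrability: \<open>P\<close> and \<open>Q\<close> are third derivatives of \<open>u\<close>, each computed in two ways.\<close>
  have d1: "P * x\<^sup>2 = 2 * b p * C * g (u p) + (b p)\<^sup>2 * ((c2 - (g (u p))\<^sup>2) * b p)"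
    using D1 unfolding P by (simp add: x_def C_def c2_def algebra_simps power2_eq_square)
  have d2: "P = B * (k ?s - a p * g (u p)) + b p * (c1 - (k ?s)\<^sup>2 - A * g (u p) - a p * ((c2 - (g (u p))\<^sup>2) * a p))"
    using D2(1) unfolding b1[OF U(2)] by (simp add: P_def A_def B_def c1_def c2_def algebra_simps)
  have d3: "Q = C * (k ?s - a p * g (u p)) + b p * (- B * g (u p) - a p * ((c2 - (g (u p))\<^sup>2) * b p))"
    using D2(2) by (simp add: Q_def C_def B_def c2_def algebra_simps)
  have d4: "Q = 2 * k ?s * x\<^sup>2 * ((a p)\<^sup>2 * g (u p) - a p * k ?s) 
     + x\<^sup>2 * (2 * a p * A * g (u p) + (a p)\<^sup>2 * ((c2 - (g (u p))\<^sup>2) * a p) - A * k ?s - a p * (c1 - (k ?s)\<^sup>2))"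
    using D3 unfolding Q kp by (simp add: x_def A_def c1_def c2_def algebra_simps power2_eq_square)
  have fr: "(a p)\<^sup>2 * x\<^sup>2 + (b p)\<^sup>2 = x\<^sup>2" using frame(3)[OF U(2)] by (simp add: x_def)
  have "x\<^sup>2 * (b p * (c1 - c2)) = 0" using d1 d2 h fr by algebra
  then have 1: "b p * (c1 - c2) = 0" using x by simp
  have "x\<^sup>2 * (a p * (c1 - c2)) = 0" using d3 d4 h fr by algebra
  then have "a p * (c1 - c2) = 0" using x by simp
  \<comment> \<open>Since \<open>(a, b / x)\<close> is a unit vector, \<open>a\<close> and \<open>b\<close> do not vanish together.\<close>
  with 1 fr x have "c1 = c2" by (metis add.right_neutral eq_iff_diff_eq_0 less_irrefl mult_eq_0_iff power_not_zero zero_power2)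
  then show ?thesis by (simp add: c1_def c2_def u_def)
qed

section \<open>The torus as a quotient of the plane\<close>

lemma jacobian_eq_mat_1: "(F has_derivative (\<lambda>h. h)) (at p) \<Longrightarrow> jacobian F (at p) = mat 1"
  unfolding jacobian_def
  by (subst frechet_derivative_at[of F "\<lambda>h. h" p, symmetric])
    (simp_all add: matrix_def mat_def axis_def vec_eq_iff)

locale discrete_planar_group =
  fixes \<Gamma> :: "(real^2) set"
  assumes zero_mem: "0 \<in> \<Gamma>"
    and diff_mem: "\<And>x y. x \<in> \<Gamma> \<Longrightarrow> y \<in> \<Gamma> \<Longrightarrow> x - y \<in> \<Gamma>"
    and discrete: "\<exists>\<delta>>0. \<forall>x\<in>\<Gamma>. norm x < \<delta> \<longrightarrow> x = 0"
begin

abbreviation "pr \<equiv> torus_proj \<Gamma>"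
abbreviation "T \<equiv> torus \<Gamma>"

lemma uminus_mem: "x \<in> \<Gamma> \<Longrightarrow> - x \<in> \<Gamma>"
  using diff_mem[OF zero_mem] by simp

lemma add_mem: "x \<in> \<Gamma> \<Longrightarrow> y \<in> \<Gamma> \<Longrightarrow> x + y \<in> \<Gamma>"
  using diff_mem[of x "- y"] uminus_mem by simp

lemma torus_proj_eq_coset: "pr p = {b. b - p \<in> \<Gamma>}"
  by (auto simp: torus_proj_def)

lemma torus_proj_eq_iff: "pr p = pr q \<longleftrightarrow> q - p \<in> \<Gamma>"
proof
  assume "pr p = pr q"
  then have "q \<in> pr p" using zero_mem by (simp add: torus_proj_eq_coset)
  then show "q - p \<in> \<Gamma>" by (simp add: torus_proj_eq_coset)
next
  assume "q - p \<in> \<Gamma>"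
  then have "b - p \<in> \<Gamma> \<longleftrightarrow> b - q \<in> \<Gamma>" for b
    using diff_mem[of "b - p" "q - p"] add_mem[of "b - q" "q - p"] by auto
  then show "pr p = pr q" by (simp add: torus_proj_eq_coset)
qed

lemma points_torus: "points T = range pr"
  by (auto simp: torus_def quotient_def torus_proj_def)

lemma params_torus: "(V, x) \<in> params T \<longleftrightarrow> x = pr \<and> open V \<and> inj_on pr V"
  by (auto simp: torus_def)

lemma params_torusI: "open V \<Longrightarrow> inj_on pr V \<Longrightarrow> (V, pr) \<in> params T"
  by (simp add: params_torus)

lemma closed_subgroup: "closed \<Gamma>"
proof -
  obtain \<delta> where "\<delta> > 0" "\<forall>x\<in>\<Gamma>. norm x < \<delta> \<longrightarrow> x = 0" using discrete by blast
  then show ?thesis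
    by (intro discrete_imp_closed[of \<delta>]) (auto simp: dist_norm dest: diff_mem)
qed

lemma injective_chart: "\<exists>V. open V \<and> p \<in> V \<and> inj_on pr V"
proof -
  obtain \<delta> where \<delta>: "\<delta> > 0" "\<And>x. x \<in> \<Gamma> \<Longrightarrow> norm x < \<delta> \<Longrightarrow> x = 0" using discrete by blast
  have "inj_on pr (ball p (\<delta> / 2))"
  proof (rule inj_onI)
    fix x y assume xy: "x \<in> ball p (\<delta> / 2)" "y \<in> ball p (\<delta> / 2)" "pr x = pr y"
    have "norm (y - x) < \<delta>"
      using xy(1,2) dist_triangle_half_r[of p y \<delta> x] by (simp add: dist_norm)
    then show "x = y" using \<delta>(2)[of "y - x"] xy(3) by (simp add: torus_proj_eq_iff)
  qed
  then show ?thesis using \<delta>(1) by (intro exI[of _ "ball p (\<delta> / 2)"]) simp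
qed

text \<open>The topology that the charts define is the quotient topology: small discs are domains of charts,
and they cover the plane.\<close>

lemma open_in_torus: "open_in_surface T A \<longleftrightarrow> A \<subseteq> range pr \<and> open (pr -` A)"
proof
  assume A: "open_in_surface T A"
  have "\<exists>S. open S \<and> p \<in> S \<and> S \<subseteq> pr -` A" if "pr p \<in> A" for p
  proof -
    obtain V where V: "open V" "p \<in> V" "inj_on pr V" using injective_chart by blast
    then have "open {q \<in> V. pr q \<in> A}"
      using A params_torusI[OF V(1,3)] unfolding open_in_surface_def by fast
    then show ?thesis using V(2) that by (intro exI[of _ "{q \<in> V. pr q \<in> A}"]) auto
  qed
  then have "open (pr -` A)" by (subst open_subopen) simp
  then show "A \<subseteq> range pr \<and> open (pr -` A)"
    using A by (simp add: open_in_surface_def points_torus)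
next
  assume A: "A \<subseteq> range pr \<and> open (pr -` A)"
  have "{p \<in> V. pr p \<in> A} = V \<inter> pr -` A" for V by auto
  then show "open_in_surface T A"
    using A by (auto simp: open_in_surface_def points_torus params_torus)
qed

lemma openin_torus: "openin (surface_topology T) A \<longleftrightarrow> A \<subseteq> range pr \<and> open (pr -` A)"
  by (simp add: openin_surface_topology open_in_torus)

lemma topspace_torus: "topspace (surface_topology T) = range pr"
proof -
  have "openin (surface_topology T) (range pr)" by (simp add: openin_torus vimage_def)
  then show ?thesis
    using openin_subset[of "surface_topology T" "range pr"] openin_topspace[of "surface_topology T"]
      openin_torus[of "topspace (surface_topology T)"] by (intro subset_antisym) simp_all
qed

lemma quotient_map_torus_proj: "quotient_map euclidean (surface_topology T) pr"
  by (auto simp: quotient_map_def topspace_torus openin_torus vimage_def)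

text \<open>The preimage is the union of the translates of \<open>U - v\<close> by elements of \<open>\<Gamma>\<close>. The shift \<open>v\<close> makes the lemma apply
to the coordinate expressions of translations of the torus, not only to the projection.\<close>

lemma open_saturation:
  assumes "open U"
  shows "open {p. pr (p + v) \<in> pr ` U}"
proof -
  have "{p. pr (p + v) \<in> pr ` U} = (\<Union>\<gamma>\<in>\<Gamma>. (\<lambda>p. p + v + \<gamma>) -` U)"
  proof (intro set_eqI iffI)
    fix p assume "p \<in> {p. pr (p + v) \<in> pr ` U}"
    then obtain q where q: "q \<in> U" "q - (p + v) \<in> \<Gamma>" by (auto simp: torus_proj_eq_iff)
    then show "p \<in> (\<Union>\<gamma>\<in>\<Gamma>. (\<lambda>p. p + v + \<gamma>) -` U)"
      by (intro UN_I[of "q - (p + v)"]) simp_all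
  next
    fix p assume "p \<in> (\<Union>\<gamma>\<in>\<Gamma>. (\<lambda>p. p + v + \<gamma>) -` U)"
    then obtain \<gamma> where "\<gamma> \<in> \<Gamma>" "p + v + \<gamma> \<in> U" by auto
    moreover from this have "pr (p + v) = pr (p + v + \<gamma>)" by (simp add: torus_proj_eq_iff)
    ultimately show "p \<in> {p. pr (p + v) \<in> pr ` U}" by auto
  qed
  then show ?thesis using assms by (auto intro!: open_vimage continuous_intros)
qed

lemma open_map_torus_proj: "open_map euclidean (surface_topology T) pr"
  using open_saturation[of _ 0] by (auto simp: open_map_def openin_torus vimage_def)

lemma second_countable_torus: "second_countable (surface_topology T)"
proof (rule second_countable_open_map_image[OF _ open_map_torus_proj])
  show "continuous_map euclidean (surface_topology T) pr"
    by (rule quotient_imp_continuous_map[OF quotient_map_torus_proj])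
  show "pr ` topspace euclidean = topspace (surface_topology T)" by (simp add: topspace_torus)
  obtain B :: "(real^2) set set" where B: "countable B" "topological_basis B"
    using ex_countable_basis by blast
  then show "second_countable (euclidean :: (real^2) topology)"
    unfolding second_countable_def
    using topological_basis_open[OF B(2)] topological_basisE[OF B(2)]
    by (intro exI[of _ B]) (simp, metis)
qed

text \<open>The subgroup is closed, so \<open>q - p\<close> has a positive distance \<open>e\<close> from it whenever \<open>p\<close> and \<open>q\<close> project to
different points; the discs of radius \<open>e / 2\<close> around \<open>p\<close> and \<open>q\<close> then have disjoint projections.\<close>

lemma Hausdorff_torus: "Hausdorff_space (surface_topology T)"
  unfolding Hausdorff_space_def topspace_torus
proof (intro allI impI, elim conjE)
  fix x y assume "x \<in> range pr" "y \<in> range pr" "x \<noteq> y"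
  then obtain p q where pq: "x = pr p" "y = pr q" "q - p \<notin> \<Gamma>" using torus_proj_eq_iff by blast
  then obtain e where e: "e > 0" "\<And>z. z \<in> \<Gamma> \<Longrightarrow> e \<le> dist (q - p) z"
    using separate_point_closed[OF closed_subgroup, of "q - p"] by auto
  let ?U = "pr ` ball p (e / 2)" and ?V = "pr ` ball q (e / 2)"
  have "openin (surface_topology T) ?U" "openin (surface_topology T) ?V"
    using open_map_torus_proj by (auto simp: open_map_def)
  moreover have "disjnt ?U ?V"
  proof (rule ccontr)
    assume "\<not> disjnt ?U ?V"
    then obtain a b where ab: "dist p a < e / 2" "dist q b < e / 2" "b - a \<in> \<Gamma>"
      by (auto simp: disjnt_def torus_proj_eq_iff)
    have "dist (q - p) (b - a) \<le> dist q b + dist p a"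
      using norm_triangle_ineq4[of "q - b" "p - a"] by (simp add: dist_norm algebra_simps)
    then show False using e(2)[OF ab(3)] ab(1,2) by simp
  qed
  ultimately show "\<exists>U V. openin (surface_topology T) U \<and> openin (surface_topology T) V \<and> x \<in> U \<and> y \<in> V \<and> disjnt U V"
    using e(1) pq(1,2) by (intro exI[of _ ?U] exI[of _ ?V]) auto
qed

lemma connected_torus: "connected_space (surface_topology T)"
proof (rule connected_space_quotient_map_image[OF quotient_map_torus_proj])
  show "connected_space (euclidean :: (real^2) topology)"
    using connectedin_topspace[of "euclidean :: (real^2) topology"]
      convex_connected[OF convex_UNIV, where 'a = "real^2"] by simp
qed

text \<open>Near \<open>p\<close> the expression is \<open>q \<mapsto> q + v + \<gamma>\<close> for the element \<open>\<gamma>\<close> of \<open>\<Gamma>\<close> that carries \<open>p + v\<close> into \<open>W\<close>. With \<open>v = 0\<close>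
this covers the transition maps and the projection itself, with general \<open>v\<close> the translations of
the torus.\<close>

lemma chart_translation:
  assumes W: "open W" "inj_on pr W" and p: "pr (p + v) \<in> pr ` W"
  shows "((\<lambda>q. inv_into W pr (pr (q + v))) has_derivative (\<lambda>h. h)) (at p)"
proof -
  obtain q\<^sub>0 where q0: "q\<^sub>0 \<in> W" "pr (p + v) = pr q\<^sub>0" using p by blast
  define \<gamma> where "\<gamma> = q\<^sub>0 - (p + v)"
  have \<gamma>: "\<gamma> \<in> \<Gamma>" using q0(2) by (simp add: \<gamma>_def torus_proj_eq_iff)
  let ?N = "(\<lambda>q. q + (v + \<gamma>)) -` W"
  have "inv_into W pr (pr (q + v)) = q + (v + \<gamma>)" if "q \<in> ?N" for q
  proof -
    have "pr (q + v) = pr (q + (v + \<gamma>))" using \<gamma> by (simp add: torus_proj_eq_iff)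
    then show ?thesis using inv_into_f_f[OF W(2), of "q + (v + \<gamma>)"] that by simp
  qed
  moreover have "open ?N" by (intro open_vimage W continuous_intros)
  moreover have "p \<in> ?N" using q0 by (simp add: \<gamma>_def)
  moreover have "((\<lambda>q. q + (v + \<gamma>)) has_derivative (\<lambda>h. h)) (at p)"
    by (auto intro!: derivative_eq_intros)
  ultimately show ?thesis
    using has_derivative_cong_open[of ?N p "\<lambda>q. inv_into W pr (pr (q + v))" "\<lambda>q. q + (v + \<gamma>)"] by simp
qed

text \<open>The map \<open>x\<close> is the projection when the domain is the torus, and the identity when it is the plane.\<close>

lemma open_smooth_chart_translation:
  assumes V: "open V" and W: "open W" "inj_on pr W" and \<phi>: "\<And>p. \<phi> (x p) = pr (p + v)"
  shows "open {p \<in> V. \<phi> (x p) \<in> pr ` W}"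
    and "smooth_on {p \<in> V. \<phi> (x p) \<in> pr ` W} (inv_into W pr \<circ> \<phi> \<circ> x)"
proof -
  have "{p \<in> V. \<phi> (x p) \<in> pr ` W} = V \<inter> {p. pr (p + v) \<in> pr ` W}" by (auto simp: \<phi>)
  then show o: "open {p \<in> V. \<phi> (x p) \<in> pr ` W}" using V open_saturation[OF W(1)] by auto
  show "smooth_on {p \<in> V. \<phi> (x p) \<in> pr ` W} (inv_into W pr \<circ> \<phi> \<circ> x)"
    by (rule smooth_on_local_translation[OF o]) (simp add: comp_def \<phi> chart_translation[OF W])
qed

lemma pullback_chart_translation:
  fixes G :: "real^2 \<Rightarrow> real^2^2"
  assumes W: "open W" "inj_on pr W" "q \<in> W" "\<phi> (x p) = pr q" and \<phi>: "\<And>p. \<phi> (x p) = pr (p + v)"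
    and G: "\<And>p \<gamma>. \<gamma> \<in> \<Gamma> \<Longrightarrow> G (p + v + \<gamma>) = G p"
  shows "let J = jacobian (inv_into W pr \<circ> \<phi> \<circ> x) (at p) in G p = transpose J ** G q ** J"
proof -
  have q: "pr (p + v) = pr q" using W(4) by (simp add: \<phi>)
  have "jacobian (inv_into W pr \<circ> \<phi> \<circ> x) (at p) = mat 1"
    using chart_translation[OF W(1,2), of p v] W(3) q
    by (intro jacobian_eq_mat_1) (auto simp: comp_def \<phi>)
  moreover have "G p = G q"
    using G[of "q - (p + v)" p] q by (simp add: torus_proj_eq_iff)
  ultimately show ?thesis by (simp add: transpose_mat)
qed

lemma smooth_map_torus_translation:
  assumes "\<And>p. \<phi> (pr p) = pr (p + v)"
  shows "smooth_map T T \<phi>"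
  using open_smooth_chart_translation[of _ _ \<phi> pr v] assms
  by (auto simp: smooth_map_def points_torus params_torus)

lemma is_pullback_torus_translation:
  assumes "\<And>p. \<phi> (pr p) = pr (p + v)" and "\<And>p \<gamma>. \<gamma> \<in> \<Gamma> \<Longrightarrow> G (p + v + \<gamma>) = G p"
  shows "is_pullback T (\<lambda>_. G) T (\<lambda>_. G) \<phi>"
  unfolding is_pullback_def
  using pullback_chart_translation[where x = pr and \<phi> = \<phi> and v = v and G = G] assms
  by (fastforce simp: params_torus)

lemma smooth_surface_torus: "smooth_surface T"
proof -
  have "points T = (\<Union>(V, x) \<in> params T. x ` V)"
  proof
    show "points T \<subseteq> (\<Union>(V, x) \<in> params T. x ` V)"
      using injective_chart params_torusI by (fastforce simp: points_torus)
    show "(\<Union>(V, x) \<in> params T. x ` V) \<subseteq> points T" by (auto simp: points_torus params_torus)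
  qed
  moreover have "smooth_map T T id" by (rule smooth_map_torus_translation[of _ 0]) simp
  ultimately show ?thesis
    using Hausdorff_torus second_countable_torus
    by (auto simp: smooth_surface_def params_torus points_torus)
qed

lemma descends_to_torus:
  assumes "\<And>p \<gamma>. \<gamma> \<in> \<Gamma> \<Longrightarrow> G (p + \<gamma>) = G p"
  shows "descends_to plane (\<lambda>_. G) T (\<lambda>_. G) pr"
proof -
  have "smooth_map plane T pr"
    using open_smooth_chart_translation[of UNIV _ pr id 0]
    by (auto simp: smooth_map_def plane_def points_torus params_torus)
  moreover have "is_pullback plane (\<lambda>_. G) T (\<lambda>_. G) pr"
    unfolding is_pullback_def
    using pullback_chart_translation[where x = id and \<phi> = pr and v = 0 and G = G] assms
    by (fastforce simp: plane_def params_torus)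
  ultimately show ?thesis by (simp add: descends_to_def plane_def points_torus)
qed

lemma translation_coset: "(\<lambda>p. p + w) ` pr p = pr (p + w)"
proof (intro set_eqI iffI)
  fix b assume "b \<in> pr (p + w)"
  then show "b \<in> (\<lambda>p. p + w) ` pr p"
    by (intro image_eqI[of _ _ "b - w"]) (simp_all add: torus_proj_eq_coset algebra_simps)
qed (auto simp: torus_proj_eq_coset)

lemma isometry_translation:
  assumes G: "\<And>p \<gamma>. \<gamma> \<in> \<Gamma> \<Longrightarrow> G (p + w + \<gamma>) = G p"
  shows "isometry T (\<lambda>_. G) T (\<lambda>_. G) (image (\<lambda>p. p + w))"
proof -
  let ?\<phi> = "image (\<lambda>p. p + w)"
  have inj: "inj_on ?\<phi> (range pr)"
    by (rule inj_on_subset[of _ UNIV]) (auto intro!: inj_image_eq_iff injI simp: inj_image_eq_iff inj_def)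
  have inv: "inv_into (points T) ?\<phi> (pr p) = pr (p + (- w))" for p
    unfolding points_torus by (rule inv_into_f_eq[OF inj]) (simp_all add: translation_coset)
  have "?\<phi> ` range pr = range pr"
    using translation_coset[of w] by (auto simp: image_iff) (metis diff_add_cancel)
  then have "bij_betw ?\<phi> (points T) (points T)"
    using inj by (simp add: bij_betw_def points_torus)
  then show ?thesis
    unfolding isometry_def
    using smooth_map_torus_translation[of ?\<phi> w] smooth_map_torus_translation[OF inv]
      is_pullback_torus_translation[of ?\<phi> w G] translation_coset G by simp
qed

end

section \<open>The two-parameter family\<close>

lemma discrete_planar_group_lattice:
  assumes "\<tau> > 0" "\<gamma>2 \<noteq> 0"
  shows "discrete_planar_group (lattice \<tau> \<gamma>1 \<gamma>2)"
proof
  show "0 \<in> lattice \<tau> \<gamma>1 \<gamma>2"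
    unfolding lattice_def by (intro CollectI exI[of _ 0]) simp
next
  fix x y assume "x \<in> lattice \<tau> \<gamma>1 \<gamma>2" "y \<in> lattice \<tau> \<gamma>1 \<gamma>2"
  then obtain a b a' b' :: int where "x = of_int a *\<^sub>R vector [\<tau>, \<gamma>1] + of_int b *\<^sub>R vector [0, \<gamma>2]"
    "y = of_int a' *\<^sub>R vector [\<tau>, \<gamma>1] + of_int b' *\<^sub>R vector [0, \<gamma>2]"
    unfolding lattice_def by blast
  then show "x - y \<in> lattice \<tau> \<gamma>1 \<gamma>2"
    unfolding lattice_def
    by (intro CollectI exI[of _ "a - a'"] exI[of _ "b - b'"]) (simp add: scaleR_left_diff_distrib)
next
  have "x = 0" if x: "x \<in> lattice \<tau> \<gamma>1 \<gamma>2" and n: "norm x < min \<tau> \<bar>\<gamma>2\<bar>" for x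
  proof -
    obtain a b :: int where ab: "x = of_int a *\<^sub>R vector [\<tau>, \<gamma>1] + of_int b *\<^sub>R vector [0, \<gamma>2]"
      using x unfolding lattice_def by blast
    have small: "k = 0" if "\<bar>of_int k * r\<bar> < \<bar>r\<bar>" for k :: int and r :: real
    proof -
      have "\<bar>of_int k\<bar> * \<bar>r\<bar> < 1 * \<bar>r\<bar>" using that by (simp only: abs_mult mult_1)
      then have "\<bar>of_int k :: real\<bar> < 1" by (rule mult_right_less_imp_less) simp
      then show "k = 0" by linarith
    qed
    have "\<bar>x $ i\<bar> < min \<tau> \<bar>\<gamma>2\<bar>" for i
      using component_le_norm_cart[of x i] n by linarith
    from this[of 1] this[of 2] have c: "\<bar>of_int a * \<tau>\<bar> < \<tau>" "\<bar>of_int a * \<gamma>1 + of_int b * \<gamma>2\<bar> < \<bar>\<gamma>2\<bar>"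
      using ab by simp_all
    then have "a = 0" using small[of a \<tau>] assms(1) by simp
    moreover from this have "b = 0" using small[of b \<gamma>2] c(2) by simp
    ultimately show "x = 0" using ab by simp
  qed
  moreover have "min \<tau> \<bar>\<gamma>2\<bar> > 0" using assms by simp
  ultimately show "\<exists>\<delta>>0. \<forall>x\<in>lattice \<tau> \<gamma>1 \<gamma>2. norm x < \<delta> \<longrightarrow> x = 0"
    by (intro exI[of _ "min \<tau> \<bar>\<gamma>2\<bar>"]) simp
qed

context discrete_planar_group
begin

text \<open>Around \<open>p\<close> and \<open>q\<close> the isometry has a coordinate expression that is a local isometry of the two
metrics on the plane.\<close>

lemma isometry_torus_curvature:
  assumes W1: "warped_plane f1 f1' f1''" and W2: "warped_plane f2 f2' f2''"
    and iso: "isometry T (\<lambda>_ p. diag2 ((f1 (p $ 1))\<^sup>2)) T (\<lambda>_ p. diag2 ((f2 (p $ 1))\<^sup>2)) \<phi>"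
    and pq: "\<phi> (pr p) = pr q"
  shows "f1'' (p $ 1) / f1 (p $ 1) = f2'' (q $ 1) / f2 (q $ 1)"
proof -
  obtain V where V: "open V" "p \<in> V" "inj_on pr V" using injective_chart by blast
  obtain W where W: "open W" "q \<in> W" "inj_on pr W" using injective_chart by blast
  note charts = params_torusI[OF V(1,3)] params_torusI[OF W(1,3)]
  let ?\<psi> = "inv_into W pr \<circ> \<phi> \<circ> pr"
  let ?U = "{p \<in> V. \<phi> (pr p) \<in> pr ` W}"
  have sm: "smooth_map T T \<phi>" and pb: "is_pullback T (\<lambda>_ p. diag2 ((f1 (p $ 1))\<^sup>2)) T (\<lambda>_ p. diag2 ((f2 (p $ 1))\<^sup>2)) \<phi>"
    using iso by (simp_all add: isometry_def)
  from bspec[OF conjunct2[OF sm[unfolded smooth_map_def]] charts(1)]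
  have "\<forall>(W, y) \<in> params T. open {p \<in> V. \<phi> (pr p) \<in> y ` W} \<and>
     smooth_on {p \<in> V. \<phi> (pr p) \<in> y ` W} (inv_into W y \<circ> \<phi> \<circ> pr)"
    by (simp only: split_conv)
  from bspec[OF this charts(2)] have U: "open ?U" "smooth_on ?U ?\<psi>" by simp_all
  from bspec[OF pb[unfolded is_pullback_def] charts(1)]
  have "\<forall>(W, y) \<in> params T. \<forall>p \<in> V. \<forall>q \<in> W. \<phi> (pr p) = y q \<longrightarrow>
     (let J = jacobian (inv_into W y \<circ> \<phi> \<circ> pr) (at p)
      in diag2 ((f1 (p $ 1))\<^sup>2) = transpose J ** diag2 ((f2 (q $ 1))\<^sup>2) ** J)"
    by (simp only: split_conv)
  from bspec[OF this charts(2)]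
  have pull: "diag2 ((f1 (x $ 1))\<^sup>2) =
      transpose (jacobian ?\<psi> (at x)) ** diag2 ((f2 (y $ 1))\<^sup>2) ** jacobian ?\<psi> (at x)"
    if "x \<in> V" "y \<in> W" "\<phi> (pr x) = pr y" for x y
    using that by (simp add: Let_def)
  have "diag2 ((f1 (x $ 1))\<^sup>2) =
       transpose (jacobian ?\<psi> (at x)) ** diag2 ((f2 (?\<psi> x $ 1))\<^sup>2) ** jacobian ?\<psi> (at x)" if "x \<in> ?U" for x
    using that by (intro pull) (auto simp: inv_into_into f_inv_into_f)
  moreover have "?\<psi> p = q" using pq W by simp
  moreover have "p \<in> ?U" using V(2) W(2) pq by simp
  ultimately show ?thesis
    using local_isometry_curvature[OF W1 W2 U(1) _ U(2), of p] by simp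
qed

end

text \<open>With \<open>F = f\<^sup>2 = (l + r sin (\<omega>s)) / c\<close> one has \<open>F'\<^sup>2 = - 4 m - 4 c F\<^sup>2 + 8 l F\<close> and \<open>F'' = 4 l - 4 c F\<close>, hence
\<open>f'' / f = F'' / (2 F) - F'\<^sup>2 / (4 F\<^sup>2) = - c + m / f\<^sup>4\<close>. This explains the formula for the second
derivative below.\<close>

locale sigma_family =
  fixes c m l :: real
  assumes c: "c > 0" and ml: "(m, l) \<in> Lam c"
begin

definition "r = sqrt (l\<^sup>2 - c * m)"
abbreviation "f \<equiv> warp c m l"
abbreviation "\<omega> \<equiv> 2 * sqrt c"
definition "f' s = r * cos (\<omega> * s) / (sqrt c * f s)"
definition "f'' s = (- c + m / f s ^ 4) * f s"

lemma parameters: "m > 0" "0 < r" "r < l" "r\<^sup>2 = l\<^sup>2 - c * m" "l > 0"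
proof -
  have m: "m > 0" "l > sqrt (c * m)" using ml by (auto simp: Lam_def)
  have "sqrt (c * m) > 0" using c m by simp
  then have l: "l > 0" using m(2) by linarith
  have "c * m < l\<^sup>2" using m(2) c m(1) l by (smt (verit) real_sqrt_less_iff real_sqrt_abs)
  then show "0 < r" "r\<^sup>2 = l\<^sup>2 - c * m" by (simp_all add: r_def)
  have "r < sqrt (l\<^sup>2)" unfolding r_def using c m by (subst real_sqrt_less_iff) simp
  then show "r < l" using l by simp
  show "m > 0" "l > 0" by fact+
qed

lemma warp_square: "(f s)\<^sup>2 = (l + r * sin (\<omega> * s)) / c" and warp_pos: "f s > 0"
proof -
  have "\<bar>r * sin (\<omega> * s)\<bar> \<le> r" using parameters(2) abs_sin_le_one[of "\<omega> * s"] by (simp add: abs_mult)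
  then have "l + r * sin (\<omega> * s) > 0" using parameters(3) by linarith
  then show "(f s)\<^sup>2 = (l + r * sin (\<omega> * s)) / c" "f s > 0" using c by (simp_all add: warp_def r_def)
qed

lemma DERIV_warp: "(f has_real_derivative f' s) (at s)"
proof -
  have "(f s)\<^sup>2 > 0" using warp_pos[of s] by simp
  then have "((\<lambda>s. sqrt ((l + r * sin (\<omega> * s)) / c)) has_real_derivative
      (inverse (sqrt ((l + r * sin (\<omega> * s)) / c)) / 2) * (r * (cos (\<omega> * s) * \<omega>) / c)) (at s)"
    using c unfolding warp_square
    by (intro DERIV_chain2[OF DERIV_real_sqrt]) (auto intro!: derivative_eq_intros)
  moreover have "(\<lambda>s. sqrt ((l + r * sin (\<omega> * s)) / c)) = f" by (simp add: fun_eq_iff warp_def r_def)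
  ultimately have "(f has_real_derivative (inverse (f s) / 2) * (r * (cos (\<omega> * s) * \<omega>) / c)) (at s)"
    by (simp add: fun_eq_iff)
  moreover have "sqrt c * sqrt c = c" using c by simp
  then have "(inverse (f s) / 2) * (r * (cos (\<omega> * s) * \<omega>) / c) = f' s"
    using warp_pos[of s] c by (simp add: f'_def field_simps)
  ultimately show ?thesis by simp
qed

lemma DERIV_warp': "(f' has_real_derivative f'' s) (at s)"
proof -
  have c2: "sqrt c * sqrt c = c" using c by simp
  have nz: "f s \<noteq> 0" using warp_pos[of s] by simp
  let ?S = "sin (\<omega> * s)" and ?C = "cos (\<omega> * s)"
  have 1: "(f' has_real_derivative
     ((r * - (?S * \<omega>)) * (sqrt c * f s) - r * ?C * (sqrt c * f' s)) / (sqrt c * f s * (sqrt c * f s))) (at s)"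
    unfolding f'_def[abs_def]
    by (rule DERIV_divide) (use nz c in \<open>auto intro!: derivative_eq_intros DERIV_warp[unfolded f'_def]\<close>)
  have q: "c * (f s)\<^sup>2 = l + r * ?S" using warp_square[of s] c by simp
  have sc: "?S\<^sup>2 + ?C\<^sup>2 = 1" by simp
  have "((r * - (?S * \<omega>)) * (sqrt c * f s) - r * ?C * (sqrt c * f' s)) / (sqrt c * f s * (sqrt c * f s))
     = (- 2 * c * r * ?S * (f s)\<^sup>2 - r\<^sup>2 * ?C\<^sup>2) / (c * f s ^ 3)"
    unfolding f'_def using nz c c2 by (simp add: field_simps power2_eq_square power3_eq_cube) 
  also have "\<dots> = (- c * f s ^ 4 + m) / f s ^ 3"
  proof -
    have "- 2 * c * r * ?S * (f s)\<^sup>2 - r\<^sup>2 * ?C\<^sup>2 = c * (- c * ((f s)\<^sup>2)\<^sup>2 + m)"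
      using q sc parameters(4) by algebra
    moreover have "((f s)\<^sup>2)\<^sup>2 = f s ^ 4" by simp
    ultimately show ?thesis using c by (simp only: mult_divide_mult_cancel_left_if) simp
  qed
  also have "\<dots> = f'' s" unfolding f''_def using nz by (simp add: field_simps power_def numeral_eq_Suc)
  finally show ?thesis using 1 by simp
qed

sublocale warped_plane f f' f''
  by unfold_locales (auto intro: warp_pos DERIV_warp DERIV_warp')

lemma curvature_ode: "f'' s / f s = - c + m / f s ^ 4"
  using warp_pos[of s] by (simp add: f''_def)

lemma smooth_metric: "smooth_on U (\<lambda>p. G p $ i $ j)"
proof -
  have "smooth_on U (\<lambda>p. (f (p $ 1))\<^sup>2)"
    using smooth_on_sinusoid[of U "l / c" "r / c" \<omega> 0] by (simp add: warp_square add_divide_distrib)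
  then have "\<forall>i j. smooth_on U (\<lambda>p. G p $ i $ j)"
    by (simp add: forall_2 smooth_on_const)
  then show ?thesis by blast
qed

lemma positive_metric: "v \<noteq> 0 \<Longrightarrow> v \<bullet> (G p *v v) > 0"
proof -
  assume "v \<noteq> 0"
  then have "v $ 1 \<noteq> 0 \<or> v $ 2 \<noteq> 0" by (simp add: vec_eq_iff forall_2)
  moreover have "v \<bullet> (G p *v v) = (v $ 1)\<^sup>2 + (f (p $ 1) * v $ 2)\<^sup>2"
    by (simp add: inner_vec_def sum_2 matrix_vector_mult_def power2_eq_square)
  ultimately show "v \<bullet> (G p *v v) > 0"
    using warp_pos[of "p $ 1"] by (simp add: sum_power2_gt_zero_iff)
qed

text \<open>The shift \<open>\<pi> / \<surd>c\<close> in \<open>s\<close> is one period of \<open>sin (2 \<surd>c s)\<close>, and nothing depends on \<open>t\<close>.\<close>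

lemma metric_invariant:
  assumes "\<gamma> \<in> lattice (pi / sqrt c) \<gamma>1 \<gamma>2"
  shows "G (p + vector [0, t] + \<gamma>) = G p"
proof -
  obtain a b :: int where "\<gamma> = of_int a *\<^sub>R vector [pi / sqrt c, \<gamma>1] + of_int b *\<^sub>R vector [0, \<gamma>2]"
    using assms unfolding lattice_def by blast
  then have "\<omega> * (p + vector [0, t] + \<gamma>) $ 1 = \<omega> * p $ 1 + 2 * pi * of_int a"
    using c by (simp add: field_simps)
  then have "sin (\<omega> * (p + vector [0, t] + \<gamma>) $ 1) = sin (\<omega> * p $ 1)"
    by (simp add: sin_add)
  then show ?thesis unfolding warp_square by simp
qed

lemma curvature_term: "m / f s ^ 4 = m * c\<^sup>2 / (l + r * sin (\<omega> * s))\<^sup>2"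
proof -
  have "f s ^ 4 = ((f s)\<^sup>2)\<^sup>2" by simp
  then show ?thesis by (simp only: warp_square) (simp add: power_divide)
qed

text \<open>Here \<open>m / f\<^sup>4 = c - K\<close>, so this bounds the curvature from above; the bound is attained where the sine
is \<open>1\<close>.\<close>

lemma curvature_term_ge: "m * c\<^sup>2 / (l + r)\<^sup>2 \<le> m / f s ^ 4"
proof -
  have "\<bar>r * sin (\<omega> * s)\<bar> \<le> r" using parameters(2) abs_sin_le_one[of "\<omega> * s"] by (simp add: abs_mult)
  then have "l + r * sin (\<omega> * s) > 0" "l + r * sin (\<omega> * s) \<le> l + r" using parameters(3) by linarith+
  then show ?thesis
    unfolding curvature_term using parameters(1) by (intro divide_left_mono power_mono mult_pos_pos) auto
qed

lemma curvature_term_attained: "m / f (pi / (4 * sqrt c)) ^ 4 = m * c\<^sup>2 / (l + r)\<^sup>2"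
proof -
  have "\<omega> * (pi / (4 * sqrt c)) = pi / 2" using c by (simp add: field_simps)
  then show ?thesis unfolding curvature_term by simp
qed

end

context discrete_planar_group
begin

text \<open>An isometry is onto and preserves the curvature, so both metrics have the same maximal curvature
\<open>c - m c\<^sup>2 / (l + r)\<^sup>2\<close>.\<close>

lemma isometric_max_curvature:
  assumes "sigma_family c m l" "sigma_family c m' l'"
    and "isometric T (\<lambda>_ p. diag2 ((warp c m l (p $ 1))\<^sup>2)) T (\<lambda>_ p. diag2 ((warp c m' l' (p $ 1))\<^sup>2))"
  shows "m / (l + sqrt (l\<^sup>2 - c * m))\<^sup>2 = m' / (l' + sqrt (l'\<^sup>2 - c * m'))\<^sup>2"
proof -
  interpret S: sigma_family c m l by fact
  interpret S': sigma_family c m' l' by fact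
  obtain \<phi> where iso: "isometry T (\<lambda>_ p. diag2 ((warp c m l (p $ 1))\<^sup>2)) T (\<lambda>_ p. diag2 ((warp c m' l' (p $ 1))\<^sup>2)) \<phi>"
    using assms(3) by (auto simp: isometric_def)
  have eq: "m / warp c m l (p $ 1) ^ 4 = m' / warp c m' l' (q $ 1) ^ 4" if "\<phi> (pr p) = pr q" for p q
    using isometry_torus_curvature[OF S.warped_plane_axioms S'.warped_plane_axioms iso that]
    by (simp add: S.curvature_ode S'.curvature_ode)
  have bij: "bij_betw \<phi> (range pr) (range pr)" using iso by (simp add: isometry_def points_torus)
  let ?p = "vector [pi / (4 * sqrt c), 0] :: real^2"
  have "\<phi> (pr ?p) \<in> range pr" using bij unfolding bij_betw_def by blast
  then obtain q where "\<phi> (pr ?p) = pr q" by auto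
  from eq[OF this] have 1: "m' * c\<^sup>2 / (l' + S'.r)\<^sup>2 \<le> m * c\<^sup>2 / (l + S.r)\<^sup>2"
    using S'.curvature_term_ge[of "q $ 1"] S.curvature_term_attained by simp
  have "pr ?p \<in> \<phi> ` range pr" using bij by (simp add: bij_betw_def)
  then obtain p where "\<phi> (pr p) = pr ?p" by auto
  from eq[OF this] have 2: "m * c\<^sup>2 / (l + S.r)\<^sup>2 \<le> m' * c\<^sup>2 / (l' + S'.r)\<^sup>2"
    using S.curvature_term_ge[of "p $ 1"] S'.curvature_term_attained by simp
  have "m / (l + S.r)\<^sup>2 * c\<^sup>2 = m' / (l' + S'.r)\<^sup>2 * c\<^sup>2" using 1 2 by simp
  moreover have "c\<^sup>2 \<noteq> 0" using S.c by simp
  ultimately have "m / (l + S.r)\<^sup>2 = m' / (l' + S'.r)\<^sup>2" by (metis mult_cancel_right)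
  then show ?thesis by (simp only: S.r_def S'.r_def)
qed

lemma spherical_ricci_torus:
  assumes "sigma_family c m l" "\<Gamma> = lattice (pi / sqrt c) \<gamma>1 \<gamma>2"
  defines "h \<equiv> (\<lambda>_ p. diag2 ((warp c m l (p $ 1))\<^sup>2))"
  shows "descends_to plane (dsigma c m l) T h pr" "spherical_ricci_metric c T h" "rotationally_invariant \<Gamma> h"
proof -
  interpret S: sigma_family c m l by fact
  have inv: "S.G (p + vector [0, t] + \<gamma>) = S.G p" if "\<gamma> \<in> \<Gamma>" for p \<gamma> t
    using S.metric_invariant that assms(2) by blast
  have z: "vector [0, 0] = (0 :: real^2)" by (simp add: vec_eq_iff forall_2)
  have inv0: "S.G (p + \<gamma>) = S.G p" if "\<gamma> \<in> \<Gamma>" for p \<gamma>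
    using inv[OF that, of p 0] by (simp only: z add_0_right)
  show "descends_to plane (dsigma c m l) T h pr"
    using descends_to_torus[OF inv0] by (simp add: dsigma_def warped_metric_def h_def)
  show "rotationally_invariant \<Gamma> h"
    unfolding rotationally_invariant_def h_def using isometry_translation[OF inv] by blast
  have "is_pullback T h T h id"
    unfolding h_def by (rule is_pullback_torus_translation[where v = 0]) (simp_all only: inv0 id_apply add_0_right)
  moreover have "transpose (S.G p) = S.G p" for p
    by (simp add: vec_eq_iff forall_2 transpose_def)
  ultimately have "riemannian_metric T h"
    unfolding riemannian_metric_def h_def using S.smooth_metric S.positive_metric by simp
  then show "spherical_ricci_metric c T h"
    unfolding spherical_ricci_metric_def
    using S.c smooth_surface_torus connected_torus S.spherical_ricci_warped[OF S.curvature_ode]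
    by (simp add: h_def Let_def)
qed

end

theorem theorem4p5:
  fixes c \<gamma>1 \<gamma>2 :: real
  assumes "c > 0" and "\<gamma>2 \<noteq> 0"
  shows "let \<Gamma> = lattice (pi / sqrt c) \<gamma>1 \<gamma>2 in
    \<exists>h :: real \<Rightarrow> real \<Rightarrow> (real^2) set metric.
    (\<forall>(m, l) \<in> Lam c.
       descends_to plane (dsigma c m l) (torus \<Gamma>) (h m l) (torus_proj \<Gamma>) \<and>
       spherical_ricci_metric c (torus \<Gamma>) (h m l) \<and>
       rotationally_invariant \<Gamma> (h m l)) \<and>
    (\<exists>A. A \<subseteq> Lam c \<and> infinite A \<and>
       (\<forall>(m, l) \<in> A. \<forall>(m', l') \<in> A. (m, l) \<noteq> (m', l') \<longrightarrow>
          \<not> isometric (torus \<Gamma>) (h m l) (torus \<Gamma>) (h m' l')))"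
proof -
  define \<Gamma> where "\<Gamma> = lattice (pi / sqrt c) \<gamma>1 \<gamma>2"
  interpret discrete_planar_group \<Gamma>
    unfolding \<Gamma>_def using assms by (intro discrete_planar_group_lattice) simp_all
  define h :: "real \<Rightarrow> real \<Rightarrow> (real^2) set metric"
    where "h m l = (\<lambda>_ p. diag2 ((warp c m l (p $ 1))\<^sup>2))" for m l
  have S: "sigma_family c m l" if "(m, l) \<in> Lam c" for m l
    using assms(1) that by unfold_locales
  \<comment> \<open>Along \<open>l = 1\<close>, \<open>m = (1 - r\<^sup>2) / c\<close> the maximal curvature is
    \<open>c - c (1 - r) / (1 + r)\<close>, which is injective in \<open>r\<close>.\<close>
  define A where "A = (\<lambda>r. ((1 - r\<^sup>2) / c, 1 :: real)) ` {0<..<1}"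
  have inj: "inj_on (\<lambda>r. ((1 - r\<^sup>2) / c, 1 :: real)) {0<..<1}"
    using assms(1) by (auto simp: inj_on_def power2_eq_iff)
  have cm: "c * ((1 - r\<^sup>2) / c) = 1 - r\<^sup>2" for r using assms(1) by simp
  have A: "A \<subseteq> Lam c"
    using assms(1) by (auto simp: A_def Lam_def cm power_strict_mono abs_square_less_1 intro!: divide_pos_pos)
  have "infinite A"
    unfolding A_def using finite_imageD[OF _ inj] infinite_Ioo[of 0 "1 :: real"] by auto
  moreover have "\<not> isometric T (h m l) T (h m' l')"
    if ml: "(m, l) \<in> A" "(m', l') \<in> A" "(m, l) \<noteq> (m', l')" for m l m' l'
  proof
    assume iso: "isometric T (h m l) T (h m' l')"
    obtain r r' where r: "0 < r" "r < 1" "m = (1 - r\<^sup>2) / c" "l = 1"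
       and r': "0 < r'" "r' < 1" "m' = (1 - r'\<^sup>2) / c" "l' = 1"
      using ml(1,2) by (auto simp: A_def)
    have "m / (l + sqrt (l\<^sup>2 - c * m))\<^sup>2 = m' / (l' + sqrt (l'\<^sup>2 - c * m'))\<^sup>2"
      by (rule isometric_max_curvature[OF S[OF subsetD[OF A ml(1)]] S[OF subsetD[OF A ml(2)]]
            iso[unfolded h_def]])
    moreover have "(1 - t\<^sup>2) / c / (1 + sqrt (1\<^sup>2 - c * ((1 - t\<^sup>2) / c)))\<^sup>2 = (1 - t) / (1 + t) / c"
      if "0 < t" for t
    proof -
      have "sqrt (1\<^sup>2 - c * ((1 - t\<^sup>2) / c)) = t" using that assms(1) by simp
      moreover have "(1 - t\<^sup>2) = (1 - t) * (1 + t)" by (simp add: algebra_simps power2_eq_square)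
      ultimately show ?thesis using that by (simp only: power2_eq_square) simp
    qed
    ultimately have "(1 - r) / (1 + r) / c = (1 - r') / (1 + r') / c"
      using r r' by simp
    then have "(1 - r) / (1 + r) = (1 - r') / (1 + r')"
      using assms(1) by (metis divide_cancel_right less_irrefl)
    then have "(1 - r) * (1 + r') = (1 - r') * (1 + r)" using r(1) r'(1) by (simp add: frac_eq_eq)
    then have "r = r'" by (simp add: algebra_simps)
    then show False using ml(3) r r' by simp
  qed
  ultimately have "\<exists>A. A \<subseteq> Lam c \<and> infinite A \<and>
       (\<forall>(m, l) \<in> A. \<forall>(m', l') \<in> A. (m, l) \<noteq> (m', l') \<longrightarrow> \<not> isometric T (h m l) T (h m' l'))"
    using A by (intro exI[of _ A]) auto
  moreover have "descends_to plane (dsigma c m l) T (h m l) pr \<and> spherical_ricci_metric c T (h m l) \<and>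
     rotationally_invariant \<Gamma> (h m l)" if "(m, l) \<in> Lam c" for m l
    using spherical_ricci_torus[OF S[OF that] \<Gamma>_def] by (simp add: h_def)
  ultimately show ?thesis
    unfolding Let_def \<Gamma>_def[symmetric] by (intro exI[of _ h]) auto
qed

end
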